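(* Let $d\ge 2$, $\lambda\in\mathbb{R}$, and consider the equation (HNLS) with $\sigma=4/d$. Let $k,\gamma_0\in\mathbb{R}$ and let $A_0\in L^\infty(\mathbb{R}^d)$ be a solution of $$\Box u+\lambda|u|^{4/d}u=\bigl(k(x^2-|\mathbf{y}|^2)+\gamma_0\bigr)u .$$ Then (HNLS) admits the following family of semiclassical solutions: $$\psi(t,x,\mathbf{y})=\exp\Bigl(-\tfrac d2\int_0^t a(\tau)\,d\tau\Bigr)\,A_0\Bigl((x,\mathbf{y})\exp\bigl(-\int_0^t a(\tau)\,d\tau\bigr)\Bigr)\exp\Bigl(i a(t)\tfrac{x^2-|\mathbf{y}|^2}{4}\Bigr)\exp\Bigl(i\gamma_0\int_0^t \exp\bigl(-2\int_0^s a(\tau)\,d\tau\bigr)ds\Bigr),$$ where $a$ is the real-valued function with $$a'(t)+a(t)^2=4k\exp\Bigl(-4\int_0^t a(\tau)\,d\tau\Bigr),\qquad a(0)=a_0\in\mathbb{R}.$$ Furthermore, if $A_0(0)\neq 0$, then: 1. if $k<0$, the solution $\psi$ blows up in finite time in the $L^\infty$ norm, for any initial data $a_0$; 2. if $k=0$, the solution $\psi$ blows up at $T=-1/a_0$; 3. if $k>0$, the solution $\psi$ is global in time and its $L^\infty$ norm decays like $O(1/t)$.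
   Context: Points of $\mathbb{R}^d$ ($d\ge2$) are written $(x,\mathbf{y})$ with $x\in\mathbb{R}$, $\mathbf{y}\in\mathbb{R}^{d-1}$, and $\Box:=\partial_{xx}^2-\Delta_{\mathbf{y}}$. The hyperbolic nonlinear Schrödinger equation (HNLS) is $$iu_t+u_{xx}-\Delta_{\mathbf{y}}u+\lambda|u|^\sigma u=0,\qquad u=u(t,x,\mathbf{y}).$$ A function $u$ is a semiclassical solution of (HNLS) if $u\in C([0,T),L^\infty(\mathbb{R}^d))$ and $u$ satisfies (HNLS) in the distributional sense.
   Formalization: Continuity in L^∞ is weak-* for general A_0 (norm fails for A_0=1), and in norm if dilations and chirps act norm-continuously on A_0. For k<0 blow-up is at some finite time of either sign, positive if a_0<2√(-k). For k=0, a_0≠0 is required. A_0(0) is a limit of ball averages. *)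

theory Defs
  imports "HOL-Analysis.Analysis" "HOL-Probability.Essential_Supremum"
begin

text \<open>
  Space is \<open>real \<times> (real^'n)\<close>, with points \<open>(x, y)\<close>; its dimension is \<open>d = CARD('n) + 1 \<ge> 2\<close>.
  Every \<open>d \<ge> 2\<close> arises, since index types have at least one element.
\<close>

section \<open>The space of essentially bounded functions\<close>

definition Linf_norm :: "('a::euclidean_space \<Rightarrow> complex) \<Rightarrow> ereal" where
  "Linf_norm f = esssup lebesgue (\<lambda>z. ereal (norm (f z)))"

definition Linf :: "('a::euclidean_space \<Rightarrow> complex) \<Rightarrow> bool" where
  "Linf f \<longleftrightarrow> f \<in> borel_measurable lebesgue \<and> Linf_norm f < \<infinity>"

definition norm_continuous_in_Linf :: "real set \<Rightarrow> (real \<Rightarrow> 'a::euclidean_space \<Rightarrow> complex) \<Rightarrow> bool" where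
  "norm_continuous_in_Linf I u \<longleftrightarrow> (\<forall>t\<in>I. Linf (u t)) \<and>
     (\<forall>t\<in>I. ((\<lambda>s. Linf_norm (\<lambda>z. u s z - u t z)) \<longlongrightarrow> 0) (at t within I))"

text \<open>Continuity for the weak-* topology of \<open>L\<^sup>\<infinity>\<close> as the dual of \<open>L\<^sup>1\<close>.\<close>

definition weak_star_continuous_in_Linf :: "real set \<Rightarrow> (real \<Rightarrow> 'a::euclidean_space \<Rightarrow> complex) \<Rightarrow> bool" where
  "weak_star_continuous_in_Linf I u \<longleftrightarrow> (\<forall>t\<in>I. Linf (u t)) \<and>
     (\<forall>g. integrable lebesgue g \<longrightarrow> continuous_on I (\<lambda>t. LINT z|lebesgue. u t z * g z))"

text \<open>
  An element of \<open>L\<^sup>\<infinity>\<close> is only defined almost everywhere, so its value at a point is taken to be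
  the limit of its averages over shrinking balls. This does not depend on the representative, and
  it is the usual value at every point where some representative is continuous.
\<close>

definition has_value_at :: "('a::euclidean_space \<Rightarrow> complex) \<Rightarrow> 'a \<Rightarrow> complex \<Rightarrow> bool" where
  "has_value_at f z c \<longleftrightarrow>
     ((\<lambda>r. (LINT w:ball z r|lebesgue. f w) /\<^sub>R measure lebesgue (ball z r)) \<longlongrightarrow> c) (at_right 0)"

lemma has_value_at_cong_AE:
  assumes "f \<in> borel_measurable lebesgue" "g \<in> borel_measurable lebesgue"
    and "AE w in lebesgue. f w = g w"
  shows "has_value_at f z c \<longleftrightarrow> has_value_at g z c"
proof -
  have "(LINT w:ball z r|lebesgue. f w) = (LINT w:ball z r|lebesgue. g w)" for r
    unfolding set_lebesgue_integral_def
  proof (rule integral_cong_AE)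
    show "AE w in lebesgue. indicat_real (ball z r) w *\<^sub>R f w = indicat_real (ball z r) w *\<^sub>R g w"
      using assms(3) by eventually_elim simp
  qed (use assms(1,2) in \<open>auto intro!: borel_measurable_scaleR borel_measurable_indicator\<close>)
  then show ?thesis by (simp add: has_value_at_def)
qed

lemma has_value_at_continuous:
  fixes f :: "'a::euclidean_space \<Rightarrow> complex"
  assumes f: "f \<in> borel_measurable lebesgue" and cont: "isCont f z"
  shows "has_value_at f z (f z)"
  unfolding has_value_at_def
proof (rule tendstoI)
  fix e :: real assume "e > 0"
  then obtain r0 where r0: "r0 > 0" "\<And>w. dist w z < r0 \<Longrightarrow> dist (f w) (f z) < e / 2"
    using cont unfolding continuous_at_eps_delta by (meson half_gt_zero)
  have "dist ((LINT w:ball z r|lebesgue. f w) /\<^sub>R measure lebesgue (ball z r)) (f z) < e"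
    if r: "0 < r" "r < r0" for r
  proof -
    let ?m = "measure lebesgue (ball z r)"
    have m: "?m > 0" using r by (simp add: content_ball_pos)
    have fin: "emeasure lebesgue (ball z r) < \<infinity>" using emeasure_lborel_ball_finite[of z r] by simp
    have close: "norm (f w - f z) \<le> e / 2" if "w \<in> ball z r" for w
      using r0(2)[of w] that r by (auto simp: dist_norm norm_minus_commute dist_commute less_imp_le)
    have meas: "(\<lambda>w. f w - f z) \<in> borel_measurable lebesgue"
      using f by (intro borel_measurable_diff) auto
    have ii: "integrable lebesgue (indicat_real (ball z r))"
      using fin by (intro integrable_real_indicator) auto
    have ie: "set_integrable lebesgue (ball z r) (\<lambda>_. e / 2)"
      and ic: "set_integrable lebesgue (ball z r) (\<lambda>_. f z)"
      unfolding set_integrable_def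
      using fin by (auto intro!: integrable_scaleR_left integrable_real_indicator)
    have id: "set_integrable lebesgue (ball z r) (\<lambda>w. f w - f z)"
      unfolding set_integrable_def
    proof (rule Bochner_Integration.integrable_bound[OF ie[unfolded set_integrable_def]])
      show "(\<lambda>w. indicat_real (ball z r) w *\<^sub>R (f w - f z)) \<in> borel_measurable lebesgue"
        by (intro borel_measurable_scaleR borel_measurable_indicator meas) simp
      show "AE w in lebesgue. norm (indicat_real (ball z r) w *\<^sub>R (f w - f z))
          \<le> norm (indicat_real (ball z r) w *\<^sub>R (e / 2))"
        using close \<open>e > 0\<close> by (intro AE_I2) (simp add: indicator_def)
    qed
    have "(LINT w:ball z r|lebesgue. f w)
        = (LINT w:ball z r|lebesgue. f w - f z) + (LINT w:ball z r|lebesgue. f z)"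
      using set_integral_add(2)[OF id ic] by simp
    also have "(LINT w:ball z r|lebesgue. f z) = ?m *\<^sub>R f z"
      unfolding set_lebesgue_integral_def using ii by (subst integral_scaleR_left) auto
    finally have eq: "(LINT w:ball z r|lebesgue. f w) /\<^sub>R ?m - f z
        = (LINT w:ball z r|lebesgue. f w - f z) /\<^sub>R ?m"
      using m by (simp add: scaleR_add_right)
    have "norm (LINT w:ball z r|lebesgue. f w - f z) \<le> (LINT w:ball z r|lebesgue. e / 2)"
      unfolding set_lebesgue_integral_def
      by (rule Bochner_Integration.integral_norm_bound_integral[OF id[unfolded set_integrable_def]
            ie[unfolded set_integrable_def]])
        (use close in \<open>auto simp: indicator_def\<close>)
    also have "\<dots> = ?m * (e / 2)"
      unfolding set_lebesgue_integral_def using ii by (subst integral_scaleR_left) auto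
    finally have "norm ((LINT w:ball z r|lebesgue. f w - f z) /\<^sub>R ?m) \<le> e / 2"
      using m by (simp add: field_simps)
    then show ?thesis unfolding dist_norm eq using \<open>e > 0\<close> by linarith
  qed
  then show "\<forall>\<^sub>F r in at_right 0.
      dist ((LINT w:ball z r|lebesgue. f w) /\<^sub>R measure lebesgue (ball z r)) (f z) < e"
    using r0(1) by (auto simp: eventually_at_right_field)
qed

section \<open>Test functions and distributional solutions\<close>

definition partial :: "'a::euclidean_space \<Rightarrow> ('a \<Rightarrow> complex) \<Rightarrow> 'a \<Rightarrow> complex" where
  "partial b f z = frechet_derivative f (at z) b"

fun Ck :: "nat \<Rightarrow> ('a::euclidean_space \<Rightarrow> complex) \<Rightarrow> bool" where
  "Ck 0 f \<longleftrightarrow> continuous_on UNIV f"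
| "Ck (Suc m) f \<longleftrightarrow> (\<forall>z. f differentiable (at z)) \<and> (\<forall>b\<in>Basis. Ck m (partial b f))"

definition test_function :: "'a::euclidean_space set \<Rightarrow> ('a \<Rightarrow> complex) \<Rightarrow> bool" where
  "test_function U f \<longleftrightarrow> (\<forall>m. Ck m f) \<and>
     compact (closure {z. f z \<noteq> 0}) \<and> closure {z. f z \<noteq> 0} \<subseteq> U"

definition box_op :: "(real \<times> (real^'n) \<Rightarrow> complex) \<Rightarrow> real \<times> (real^'n) \<Rightarrow> complex" where
  "box_op f z = partial (1, 0) (partial (1, 0) f) z
     - (\<Sum>j\<in>UNIV. partial (0, axis j 1) (partial (0, axis j 1) f) z)"

text \<open>The quadratic form \<open>x\<^sup>2 - |y|\<^sup>2\<close>.\<close>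

definition hyp :: "real \<times> (real^'n) \<Rightarrow> real" where
  "hyp z = (fst z)\<^sup>2 - (norm (snd z))\<^sup>2"

definition stationary_solution ::
    "real \<Rightarrow> real \<Rightarrow> real \<Rightarrow> real \<Rightarrow> (real \<times> (real^'n) \<Rightarrow> complex) \<Rightarrow> bool" where
  "stationary_solution lam \<sigma> k \<gamma>0 A \<longleftrightarrow>
     (\<forall>\<eta>. test_function UNIV \<eta> \<longrightarrow>
        (LINT z|lebesgue. A z * box_op \<eta> z + of_real (lam * norm (A z) powr \<sigma>) * A z * \<eta> z)
        = (LINT z|lebesgue. of_real (k * hyp z + \<gamma>0) * A z * \<eta> z))"

text \<open>
  The equation in the sense of distributions on \<open>interior I \<times> (real \<times> (real^'n))\<close>. A curve
  \<open>u\<close> in \<open>L\<^sup>\<infinity>\<close> acts on a test function by integrating first in space and then in time, so that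
  only the class of each \<open>u t\<close> matters. The test function vanishes for times outside \<open>interior I\<close>.
\<close>

definition hnls_distributional ::
    "real \<Rightarrow> real \<Rightarrow> real set \<Rightarrow> (real \<Rightarrow> real \<times> (real^'n) \<Rightarrow> complex) \<Rightarrow> bool" where
  "hnls_distributional lam \<sigma> I u \<longleftrightarrow>
     (\<forall>\<phi>. test_function (interior I \<times> UNIV) \<phi> \<longrightarrow>
        (LINT t|lebesgue. LINT z|lebesgue.
            u t z * (- \<i> * partial (1, 0) \<phi> (t, z) + box_op (\<lambda>w. \<phi> (t, w)) z)
          + of_real (lam * norm (u t z) powr \<sigma>) * u t z * \<phi> (t, z)) = 0)"

text \<open>
  Time intervals \<open>I\<close> are arbitrary, in order to follow a solution in both time directions;
  \<open>I = {0..<T}\<close> is the Cauchy problem for positive times.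
\<close>

definition semiclassical_solution ::
    "real \<Rightarrow> real \<Rightarrow> real set \<Rightarrow> (real \<Rightarrow> real \<times> (real^'n) \<Rightarrow> complex) \<Rightarrow> bool" where
  "semiclassical_solution lam \<sigma> I u \<longleftrightarrow>
     norm_continuous_in_Linf I u \<and> hnls_distributional lam \<sigma> I u"

definition weak_star_semiclassical_solution ::
    "real \<Rightarrow> real \<Rightarrow> real set \<Rightarrow> (real \<Rightarrow> real \<times> (real^'n) \<Rightarrow> complex) \<Rightarrow> bool" where
  "weak_star_semiclassical_solution lam \<sigma> I u \<longleftrightarrow>
     weak_star_continuous_in_Linf I u \<and> hnls_distributional lam \<sigma> I u"

text \<open>
  Dilations and multiplications by \<open>exp (i b (x\<^sup>2 - |y|\<^sup>2))\<close> are weak-* continuous on \<open>L\<^sup>\<infinity>\<close>, but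
  not norm continuous: for \<open>A = 1\<close> and \<open>b \<noteq> 0\<close> the second difference below has norm \<open>2\<close>. The
  condition holds for instance if \<open>A z = f (hyp z)\<close> with \<open>f\<close> continuous and vanishing at infinity.
\<close>

definition dilation_chirp_continuous :: "(real \<times> (real^'n) \<Rightarrow> complex) \<Rightarrow> bool" where
  "dilation_chirp_continuous A \<longleftrightarrow>
     ((\<lambda>r. Linf_norm (\<lambda>z. A (r *\<^sub>R z) - A z)) \<longlongrightarrow> 0) (at 1) \<and>
     ((\<lambda>b. Linf_norm (\<lambda>z. exp (\<i> * of_real (b * hyp z)) * A z - A z)) \<longlongrightarrow> 0) (at 0)"

section \<open>The family of solutions\<close>

text \<open>
  \<open>LBINT s=0..t\<close> is the oriented integral, also for \<open>t < 0\<close>. At endpoints of \<open>I\<close> the derivative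
  is one-sided.
\<close>

definition chirp_rate :: "real \<Rightarrow> real \<Rightarrow> real set \<Rightarrow> (real \<Rightarrow> real) \<Rightarrow> bool" where
  "chirp_rate k a0 I a \<longleftrightarrow> is_interval I \<and> 0 \<in> I \<and> a 0 = a0 \<and>
     (\<forall>t\<in>I. \<exists>a'. (a has_real_derivative a') (at t within I) \<and>
        a' + (a t)\<^sup>2 = 4 * k * exp (- 4 * (LBINT \<tau>=0..t. a \<tau>)))"

text \<open>The solution on its maximal interval of existence: it extends every other solution.\<close>

definition maximal_chirp_rate :: "real \<Rightarrow> real \<Rightarrow> real set \<Rightarrow> (real \<Rightarrow> real) \<Rightarrow> bool" where
  "maximal_chirp_rate k a0 I a \<longleftrightarrow> chirp_rate k a0 I a \<and>
     (\<forall>J b. chirp_rate k a0 J b \<longrightarrow> J \<subseteq> I \<and> (\<forall>t\<in>J. b t = a t))"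

definition psi ::
    "nat \<Rightarrow> real \<Rightarrow> (real \<times> (real^'n) \<Rightarrow> complex) \<Rightarrow> (real \<Rightarrow> real) \<Rightarrow> real \<Rightarrow> real \<times> (real^'n) \<Rightarrow> complex"
  where
  "psi d \<gamma>0 A a t z =
     of_real (exp (- (real d / 2) * (LBINT \<tau>=0..t. a \<tau>)))
     * A (exp (- (LBINT \<tau>=0..t. a \<tau>)) *\<^sub>R z)
     * exp (\<i> * of_real (a t * (hyp z / 4)))
     * exp (\<i> * of_real (\<gamma>0 * (LBINT s=0..t. exp (- 2 * (LBINT \<tau>=0..s. a \<tau>)))))"

definition blows_up_at :: "(real \<Rightarrow> 'a::euclidean_space \<Rightarrow> complex) \<Rightarrow> real set \<Rightarrow> real \<Rightarrow> bool" where
  "blows_up_at u I T \<longleftrightarrow> T \<notin> I \<and> T islimpt I \<and>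
     ((\<lambda>t. Linf_norm (u t)) \<longlongrightarrow> \<infinity>) (at T within I)"

end

theory Submission
  imports Defs
begin

text \<open>
  Write \<open>m = exp (\<integral>a)\<close>. The equation for \<open>a\<close> becomes \<open>m'' = 4 k m\<^sup>-\<^sup>3\<close>; its energy
  \<open>m'\<^sup>2 + 4 k m\<^sup>-\<^sup>2\<close> is conserved and \<open>(m\<^sup>2)''\<close> is twice the energy, so \<open>m\<^sup>2\<close> is the quadratic polynomial
  \<open>q t = 1 + 2 a\<^sub>0 t + (a\<^sub>0\<^sup>2 + 4 k) t\<^sup>2\<close>. As the norm of \<open>\<psi> t\<close> is \<open>q t powr (- d / 4)\<close> times that of \<open>A\<^sub>0\<close>,
  the roots and the growth of \<open>q\<close> decide between blow-up and decay.

  For the weak equation, substitute \<open>z = m w\<close> and move the dilation, the chirp and the phase to the test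
  function, which turns \<open>\<phi>\<close> into \<open>g t w = m powr (d / 2) * exp (i (m m' hyp w / 4 + \<gamma>\<^sub>0 \<integral>m\<^sup>-\<^sup>2)) * \<phi> (t, m w)\<close>.
  The space integral becomes \<open>- i \<integral>A\<^sub>0 \<partial>\<^sub>t g\<close> plus \<open>m\<^sup>-\<^sup>2\<close> times the stationary equation tested with \<open>g t\<close>.
  The second part vanishes for every \<open>t\<close>, and the first one after integration in time, by Fubini.
  Weak-* continuity is continuity of dilations in \<open>L\<^sup>1\<close>, again on the side of the test function.
\<close>

section \<open>Derivatives of test functions\<close>

text \<open>\<open>A0\<close> is merely bounded, so every derivative in the equation has to fall on
  \<open>\<phi>\<close>. The chirp makes this possible: a time-dependent dilation creates a
  first-order term along the radial field, and conjugating \<open>box_op\<close> with exp (i p hyp)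
  creates the same field, because the sign of the operator meets the sign of \<open>hyp\<close>. The
  rate m m' / 4 is the one for which the two radial terms cancel; the multiples of
  \<open>hyp\<close> that remain cancel by conservation of energy. The power 4 / d is the one for
  which the nonlinearity scales like \<open>box_op\<close> under the dilation. The discriminant of
  \<open>q\<close> is - 16 k, so real roots occur only for k <= 0. Two obstacles are
  measure-theoretic. Fubini needs a Borel representative of the Lebesgue measurable
  \<open>A0\<close>, and dilations and chirps are not norm continuous on all of L-infinity, so norm
  continuity in time is tied to \<open>dilation_chirp_continuous\<close>.\<close>

lemma partial_eqI: "(f has_derivative f') (at z) \<Longrightarrow> partial b f z = f' b"
  by (simp add: partial_def frechet_derivative_at[symmetric])

text \<open>\<open>Ck\<close> records continuity only at the bottom level, so lowering the order by
  one ends with differentiability implying continuity.\<close>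

lemma Ck_SucD: "Ck (Suc m) f \<Longrightarrow> Ck m f"
proof (induction m arbitrary: f)
  case 0
  then show ?case
    by (auto intro!: differentiable_imp_continuous_on simp: differentiable_on_def)
qed auto

lemma Ck_differentiable: "Ck (Suc m) f \<Longrightarrow> f differentiable (at z)"
  by (simp del: split_paired_All)

lemma Ck_partial: "Ck (Suc m) f \<Longrightarrow> b \<in> Basis \<Longrightarrow> Ck m (partial b f)"
  by simp

lemma Ck_imp_continuous_on: "Ck m f \<Longrightarrow> continuous_on UNIV f"
  by (induction m) (auto dest: Ck_SucD simp del: Ck.simps(2))

lemma partial_add:
  assumes "f differentiable (at z)" "g differentiable (at z)"
  shows "partial b (\<lambda>z. f z + g z) z = partial b f z + partial b g z"
  unfolding partial_def
  by (subst frechet_derivative_at[symmetric, OF has_derivative_add])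
    (use assms in \<open>auto simp: frechet_derivative_works\<close>)

lemma partial_mult:
  assumes "f differentiable (at z)" "g differentiable (at z)"
  shows "partial b (\<lambda>z. f z * g z) z = f z * partial b g z + partial b f z * g z"
  unfolding partial_def
  by (subst frechet_derivative_at[symmetric, OF has_derivative_mult])
    (use assms in \<open>auto simp: frechet_derivative_works\<close>)

lemma partial_const: "partial b (\<lambda>z. c) z = 0"
  by (rule partial_eqI[where f' = "\<lambda>_. 0"]) simp

lemma Ck_const: "Ck m (\<lambda>z. c)"
proof (induction m arbitrary: c)
  case (Suc m)
  have "partial b (\<lambda>z. c) = (\<lambda>z. 0)" for b :: 'a
    by (intro ext partial_const)
  then show ?case using Suc by simp
qed simp

lemma Ck_add: "Ck m f \<Longrightarrow> Ck m g \<Longrightarrow> Ck m (\<lambda>z. f z + g z)"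
proof (induction m arbitrary: f g)
  case (Suc m)
  then have "partial b (\<lambda>z. f z + g z) = (\<lambda>z. partial b f z + partial b g z)" for b
    by (intro ext partial_add) auto
  then show ?case using Suc by (auto intro!: derivative_intros)
qed (auto intro: continuous_intros)

lemma Ck_mult: "Ck m f \<Longrightarrow> Ck m g \<Longrightarrow> Ck m (\<lambda>z. f z * g z)"
proof (induction m arbitrary: f g)
  case (Suc m)
  then have "partial b (\<lambda>z. f z * g z) = (\<lambda>z. f z * partial b g z + partial b f z * g z)" for b
    by (intro ext partial_mult) auto
  moreover have "Ck m f" "Ck m g" using Suc.prems by (auto intro: Ck_SucD simp del: Ck.simps(2))
  ultimately show ?case using Suc by (auto intro!: Ck_add derivative_intros)
qed (auto intro: continuous_intros)

text \<open>Test functions enter with time frozen and space dilated. Treating both at once serves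
  the substitution z = r w and, with r = 1, the plain slice that occurs in the equation.\<close>

lemma has_derivative_scale_slice:
  assumes "f differentiable (at (t, r *\<^sub>R z))"
  shows "((\<lambda>z. f (t, r *\<^sub>R z)) has_derivative (\<lambda>h. frechet_derivative f (at (t, r *\<^sub>R z)) (0, r *\<^sub>R h))) (at z)"
proof -
  have "((\<lambda>z. (t, r *\<^sub>R z)) has_derivative (\<lambda>h. (0, r *\<^sub>R h))) (at z)"
    by (auto intro!: derivative_eq_intros)
  from has_derivative_compose[OF this, of f "frechet_derivative f (at (t, r *\<^sub>R z))"] assms
  show ?thesis by (simp add: frechet_derivative_works)
qed

lemma partial_scale_slice:
  assumes "f differentiable (at (t, r *\<^sub>R z))"
  shows "partial b (\<lambda>z. f (t, r *\<^sub>R z)) z = of_real r * partial (0, b) f (t, r *\<^sub>R z)"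
proof -
  interpret linear "frechet_derivative f (at (t, r *\<^sub>R z))"
    using assms by (rule linear_frechet_derivative)
  have "partial b (\<lambda>z. f (t, r *\<^sub>R z)) z = frechet_derivative f (at (t, r *\<^sub>R z)) (r *\<^sub>R (0, b))"
    using partial_eqI[OF has_derivative_scale_slice[OF assms]] by simp
  then show ?thesis unfolding scale partial_def by (simp add: scaleR_conv_of_real)
qed

lemma Ck_scale_slice: "Ck m f \<Longrightarrow> Ck m (\<lambda>z. f (t, r *\<^sub>R z))"
proof (induction m arbitrary: f)
  case 0
  then show ?case
    by (auto intro!: continuous_on_compose2[of UNIV f] continuous_intros)
next
  case (Suc m)
  then have "partial b (\<lambda>z. f (t, r *\<^sub>R z)) = (\<lambda>z. of_real r * partial (0, b) f (t, r *\<^sub>R z))" for b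
    by (intro ext partial_scale_slice) auto
  moreover have "((\<lambda>z. f (t, r *\<^sub>R z)) differentiable at z)" for z
    using Suc.prems has_derivative_scale_slice[of f t r z] by (auto simp: differentiable_def)
  moreover have "Ck m (\<lambda>z. of_real r * partial (0, b) f (t, r *\<^sub>R z))" if "b \<in> Basis" for b
    using Suc.prems that by (intro Ck_mult Ck_const Suc.IH) (auto simp: Basis_prod_def)
  ultimately show ?case by simp
qed

lemma has_derivative_of_real_inner:
  "((\<lambda>z. of_real (z \<bullet> b) :: complex) has_derivative (\<lambda>h. of_real (h \<bullet> b))) (at z)"
  by (auto intro!: derivative_eq_intros)

lemma partial_of_real_inner: "partial c (\<lambda>z. of_real (z \<bullet> b)) z = of_real (c \<bullet> b)"
  by (rule partial_eqI[OF has_derivative_of_real_inner])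

lemma Ck_of_real_inner: "Ck m (\<lambda>z. of_real (z \<bullet> b))"
proof (cases m)
  case (Suc n)
  have "partial c (\<lambda>z. of_real (z \<bullet> b)) = (\<lambda>z. of_real (c \<bullet> b))" for c
    by (intro ext partial_of_real_inner)
  then show ?thesis using Suc has_derivative_of_real_inner by (auto simp: Ck_const differentiable_def)
qed (auto intro!: continuous_intros)

section \<open>Chirps and their commutation with the wave operator\<close>

definition chirp :: "real \<Rightarrow> real \<times> (real^'n) \<Rightarrow> complex" where
  "chirp p z = exp (\<i> * of_real (p * hyp z))"

text \<open>The sign of the form is put on the direction \<open>h\<close>, not on \<open>z\<close>:
  for a fixed direction this is the inner product of \<open>z\<close> with a fixed vector, the kind
  of function that \<open>Ck_of_real_inner\<close> handles.\<close>

lemma hyp_has_derivative: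
  fixes z :: "real \<times> (real^'n)"
  shows "(hyp has_derivative (\<lambda>h. 2 * (z \<bullet> (fst h, - snd h)))) (at z)"
proof -
  have "((\<lambda>z. (fst z)\<^sup>2 - snd z \<bullet> snd z) has_derivative (\<lambda>h. 2 * (z \<bullet> (fst h, - snd h)))) (at z)"
    by (auto intro!: derivative_eq_intros simp: inner_prod_def inner_commute algebra_simps)
  moreover have "hyp = (\<lambda>z :: real \<times> (real^'n). (fst z)\<^sup>2 - snd z \<bullet> snd z)"
    by (auto simp: hyp_def dot_square_norm)
  ultimately show ?thesis by simp
qed

lemma hyp_scaleR: "hyp (r *\<^sub>R z) = r\<^sup>2 * hyp z"
  by (simp add: hyp_def power_mult_distrib algebra_simps)

lemma continuous_on_hyp [continuous_intros]: "continuous_on S hyp"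
  by (meson continuous_at_imp_continuous_on has_derivative_continuous hyp_has_derivative)

lemma chirp_has_derivative:
  "(chirp p has_derivative (\<lambda>h. \<i> * of_real (2 * p) * of_real (z \<bullet> (fst h, - snd h)) * chirp p z)) (at z)"
proof -
  have "((\<lambda>z. \<i> * of_real (p * hyp z)) has_derivative (\<lambda>h. \<i> * of_real (p * (2 * (z \<bullet> (fst h, - snd h)))))) (at z)"
    by (rule derivative_eq_intros hyp_has_derivative refl)+ auto
  from has_derivative_compose[OF this DERIV_exp[unfolded has_field_derivative_def]] show ?thesis
    unfolding chirp_def by (simp add: mult_ac)
qed

lemma partial_chirp:
  "partial b (chirp p) = (\<lambda>z. \<i> * of_real (2 * p) * of_real (z \<bullet> (fst b, - snd b)) * chirp p z)"
  by (intro ext partial_eqI[OF chirp_has_derivative])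

text \<open>Each partial derivative is a linear function times the same chirp, so
  \<open>Ck_mult\<close> raises the order by one.\<close>

lemma Ck_chirp: "Ck m (chirp p)"
proof (induction m)
  case 0
  show ?case
    by (auto simp: continuous_on_eq_continuous_at simp del: split_paired_All
        intro!: has_derivative_continuous[OF chirp_has_derivative])
next
  case (Suc m)
  moreover have "chirp p differentiable at z" for z :: "real \<times> (real^'a)"
    using chirp_has_derivative unfolding differentiable_def by blast
  ultimately show ?case by (auto simp: partial_chirp simp del: of_real_mult intro!: Ck_mult Ck_const Ck_of_real_inner)
qed

lemma norm_chirp [simp]: "norm (chirp p z) = 1"
  by (simp add: chirp_def)

lemma partial_partial_mult:
  assumes "Ck (Suc (Suc 0)) f" "Ck (Suc (Suc 0)) g" "b \<in> Basis"
  shows "partial b (partial b (\<lambda>z. f z * g z)) z =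
    f z * partial b (partial b g) z + 2 * partial b f z * partial b g z + partial b (partial b f) z * g z"
proof -
  have "partial b (\<lambda>z. f z * g z) = (\<lambda>z. f z * partial b g z + partial b f z * g z)"
    using assms by (intro ext partial_mult Ck_differentiable) 
  moreover note D = Ck_differentiable[OF assms(1)] Ck_differentiable[OF assms(2)]
    Ck_differentiable[OF Ck_partial[OF assms(1,3)]] Ck_differentiable[OF Ck_partial[OF assms(2,3)]]
  ultimately show ?thesis
    by (simp add: partial_add partial_mult D differentiable_mult algebra_simps)
qed

lemma Basis_pair:
  "(1, 0) \<in> (Basis :: (real \<times> (real^'n)) set)" "(0, axis j 1) \<in> (Basis :: (real \<times> (real^'n)) set)"
  by (auto simp: Basis_prod_def)

lemma partial_partial_chirp:
  "partial b (partial b (chirp p)) z =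
    (\<i> * of_real (2 * p) * of_real (b \<bullet> (fst b, - snd b)) - of_real ((2 * p * (z \<bullet> (fst b, - snd b)))\<^sup>2)) * chirp p z"
proof -
  let ?l = "\<lambda>z. complex_of_real (z \<bullet> (fst b, - snd b))"
  have "((\<lambda>z. (\<i> * of_real (2 * p)) * ?l z * chirp p z) has_derivative
     (\<lambda>h. (\<i> * of_real (2 * p)) * ?l z * (\<i> * of_real (2 * p) * of_real (z \<bullet> (fst h, - snd h)) * chirp p z)
       + (\<i> * of_real (2 * p)) * ?l h * chirp p z)) (at z)"
    by (intro has_derivative_mult chirp_has_derivative has_derivative_mult_right has_derivative_of_real_inner)
  from partial_eqI[OF this, of b] show ?thesis
    unfolding partial_chirp by (simp add: algebra_simps power2_eq_square)
qed

lemma hyp_sum: "hyp z = (fst z)\<^sup>2 - (\<Sum>j\<in>UNIV. (snd z $ j)\<^sup>2)"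
  by (simp add: hyp_def norm_vec_def L2_set_def sum_nonneg)

text \<open>The phase p hyp contributes in three ways: its wave operator is 2 p d with d = CARD('n)
  + 1, the indefinite square of its gradient is 4 p^2 hyp, and the cross term is 4 i p times the
  Euler field. The Euler field carries no signs because the minus of \<open>box_op\<close> in y
  meets the minus of \<open>hyp\<close>.\<close>

lemma box_op_chirp_mult:
  fixes f :: "real \<times> (real^'n) \<Rightarrow> complex"
  assumes "Ck (Suc (Suc 0)) f"
  shows "box_op (\<lambda>z. chirp p z * f z) z = chirp p z *
    (\<i> * of_real (2 * p * (real CARD('n) + 1)) * f z - of_real (4 * p\<^sup>2 * hyp z) * f z
     + \<i> * of_real (4 * p) * (of_real (fst z) * partial (1, 0) f z
         + (\<Sum>j\<in>UNIV. of_real (snd z $ j) * partial (0, axis j 1) f z)) + box_op f z)"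
proof -
  have *: "partial b (partial b (\<lambda>z. chirp p z * f z)) z = chirp p z *
      (partial b (partial b f) z + \<i> * of_real (4 * p * (z \<bullet> (fst b, - snd b))) * partial b f z
       + (\<i> * of_real (2 * p * (b \<bullet> (fst b, - snd b))) - of_real (4 * p\<^sup>2 * (z \<bullet> (fst b, - snd b))\<^sup>2)) * f z)"
    if "b \<in> Basis" for b
    unfolding partial_partial_mult[OF Ck_chirp assms that] partial_partial_chirp
    unfolding partial_chirp by (simp add: algebra_simps power2_eq_square)
  have x: "z \<bullet> (1, - 0) = fst z" "z \<bullet> (0, - axis j 1) = - snd z $ j"
    "(0 :: real, axis j 1 :: real^'n) \<bullet> (0, - axis j 1) = - 1" for j
    by (auto simp: inner_prod_def inner_axis)
  show ?thesis
    unfolding box_op_def hyp_sum *[OF Basis_pair(1)] *[OF Basis_pair(2)] fst_conv snd_conv x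
    by (simp add: algebra_simps sum.distrib sum_distrib_left sum_subtractf sum_negf)
qed

lemma box_op_scale_slice:
  fixes f :: "real \<times> (real \<times> (real^'n)) \<Rightarrow> complex"
  assumes "Ck (Suc (Suc 0)) f"
  shows "box_op (\<lambda>z. f (t, r *\<^sub>R z)) z = of_real (r\<^sup>2) * box_op (\<lambda>w. f (t, w)) (r *\<^sub>R z)"
proof -
  have B: "(0, b) \<in> Basis" if "b \<in> Basis" for b :: "real \<times> (real^'n)"
    using that by (auto simp: Basis_prod_def)
  have D: "f differentiable at w" "b \<in> Basis \<Longrightarrow> partial (0, b) f differentiable at w" for w b
    by (rule Ck_differentiable[OF assms], rule Ck_differentiable[OF Ck_partial[OF assms B]])
  have *: "partial b (partial b (\<lambda>z. f (t, s *\<^sub>R z))) z = of_real (s\<^sup>2) * partial (0, b) (partial (0, b) f) (t, s *\<^sub>R z)"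
    if "b \<in> Basis" for b :: "real \<times> (real^'n)" and s z
  proof -
    have "partial b (\<lambda>z. f (t, s *\<^sub>R z)) = (\<lambda>z. of_real s * partial (0, b) f (t, s *\<^sub>R z))"
      by (intro ext partial_scale_slice D)
    moreover have "(\<lambda>z. partial (0, b) f (t, s *\<^sub>R z)) differentiable at z"
      using has_derivative_scale_slice[OF D(2)[OF that]] unfolding differentiable_def by blast
    ultimately show ?thesis
      using that by (simp add: partial_mult partial_const partial_scale_slice D power2_eq_square)
  qed
  show ?thesis
    \<comment> \<open>Dilation 1 at the point \<open>r *\<^sub>R z\<close> expresses the right-hand
      side by the same partial derivatives of \<open>f\<close>, so only the factor r^2 is left to
      compare.\<close>
    using *[of _ r z] *[of _ 1 "r *\<^sub>R z"]
    by (simp add: box_op_def Basis_pair algebra_simps sum_distrib_left)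
qed

lemma box_op_cmult:
  assumes "Ck (Suc (Suc 0)) f"
  shows "box_op (\<lambda>z. c * f z) z = c * box_op f z"
proof -
  have "partial b (partial b (\<lambda>z. c * f z)) z = c * partial b (partial b f) z" if "b \<in> Basis" for b
  proof -
    have "partial b (\<lambda>z. c * f z) = (\<lambda>z. c * partial b f z)"
      by (intro ext) (simp add: partial_mult partial_const Ck_differentiable[OF assms])
    then show ?thesis
      by (simp add: partial_mult partial_const Ck_differentiable[OF Ck_partial[OF assms that]])
  qed
  then show ?thesis
    by (simp add: box_op_def Basis_pair algebra_simps sum_distrib_left)
qed

section \<open>The chirp rate\<close>

text \<open>With \<open>m = exp (\<integral>a)\<close>, these are \<open>m\<^sup>2\<close> and \<open>m m' = a m\<^sup>2\<close>; both are polynomials in time.\<close>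

definition dilation_sq :: "real \<Rightarrow> real \<Rightarrow> real \<Rightarrow> real" where
  "dilation_sq k a0 t = 1 + 2 * a0 * t + (a0\<^sup>2 + 4 * k) * t\<^sup>2"

definition rate_num :: "real \<Rightarrow> real \<Rightarrow> real \<Rightarrow> real" where
  "rate_num k a0 t = a0 + (a0\<^sup>2 + 4 * k) * t"

text \<open>A connected component serves all signs of \<open>k\<close> and \<open>a0\<close> without
  naming roots, and it is open and connected by construction.\<close>

definition lifespan :: "real \<Rightarrow> real \<Rightarrow> real set" where
  "lifespan k a0 = connected_component_set {t. 0 < dilation_sq k a0 t} 0"

text \<open>The integral of m^(-2): the time scale in which the stationary profile rotates at
  constant frequency.\<close>

definition clock :: "real \<Rightarrow> real \<Rightarrow> real \<Rightarrow> real" where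
  "clock k a0 t = (LBINT s=0..t. 1 / dilation_sq k a0 s)"

lemma dilation_sq_0 [simp]: "dilation_sq k a0 0 = 1"
  by (simp add: dilation_sq_def)

lemma DERIV_dilation_sq:
  "(dilation_sq k a0 has_real_derivative 2 * rate_num k a0 t) (at t within S)"
  unfolding dilation_sq_def[abs_def] rate_num_def
  by (auto intro!: derivative_eq_intros simp: algebra_simps)

lemma DERIV_rate_num:
  "(rate_num k a0 has_real_derivative (a0\<^sup>2 + 4 * k)) (at t within S)"
  unfolding rate_num_def[abs_def] by (auto intro!: derivative_eq_intros)

text \<open>Conservation of m'^2 + 4 k m^(-2), multiplied by m^2. Through this identity
  \<open>k\<close> enters the computation with test functions.\<close>

lemma dilation_sq_energy: "(a0\<^sup>2 + 4 * k) * dilation_sq k a0 t - (rate_num k a0 t)\<^sup>2 = 4 * k"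
  by (simp add: dilation_sq_def rate_num_def power2_eq_square algebra_simps)

lemma continuous_on_dilation_sq [continuous_intros]: "continuous_on S (dilation_sq k a0)"
  by (rule DERIV_continuous_on) (rule DERIV_dilation_sq)

lemma continuous_on_rate_num [continuous_intros]: "continuous_on S (rate_num k a0)"
  by (rule DERIV_continuous_on) (rule DERIV_rate_num)

lemma open_lifespan: "open (lifespan k a0)"
  unfolding lifespan_def
  by (intro open_connected_component open_Collect_less continuous_intros)

lemma is_interval_lifespan: "is_interval (lifespan k a0)"
  by (simp add: lifespan_def is_interval_connected_1)

lemma dilation_sq_pos: "t \<in> lifespan k a0 \<Longrightarrow> 0 < dilation_sq k a0 t"
  unfolding lifespan_def using connected_component_subset by fastforce

lemma subset_lifespan:
  "is_interval I \<Longrightarrow> 0 \<in> I \<Longrightarrow> (\<And>t. t \<in> I \<Longrightarrow> 0 < dilation_sq k a0 t) \<Longrightarrow> I \<subseteq> lifespan k a0"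
  unfolding lifespan_def by (intro connected_component_maximal) (auto simp: is_interval_connected_1)

lemma zero_in_lifespan [simp]: "0 \<in> lifespan k a0"
  by (auto simp: lifespan_def)

lemma segment_subset_interval:
  fixes c :: real
  assumes "is_interval I" "c \<in> I" "t \<in> I"
  shows "{min c t..max c t} \<subseteq> I"
proof
  fix x assume "x \<in> {min c t..max c t}"
  then show "x \<in> I"
    using mem_is_interval_1_I[OF assms(1), of c t x] mem_is_interval_1_I[OF assms(1), of t c x] assms(2,3)
    by (auto simp: min_def max_def split: if_splits)
qed

text \<open>The fundamental theorem gives a derivative within a compact segment, so the segment is
  stretched until it contains \<open>c\<close> and has \<open>t\<close> in its interior.\<close>

lemma DERIV_interval_integral:
  fixes f :: "real \<Rightarrow> real"
  assumes "open I" "is_interval I" "c \<in> I" "t \<in> I" "continuous_on I f"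
  shows "((\<lambda>t. LBINT s=c..t. f s) has_real_derivative f t) (at t)"
proof -
  obtain e where e: "e > 0" "cball t e \<subseteq> I"
    using assms open_contains_cball by blast
  define l u where "l = min c (t - e)" and "u = max c (t + e)"
  have "t - e \<in> I" "t + e \<in> I" using e by (auto simp: subset_iff dist_real_def)
  then have lu: "l \<in> I" "u \<in> I" using assms(3) by (auto simp: l_def u_def min_def max_def)
  then have "{l..u} \<subseteq> I"
    using segment_subset_interval[OF assms(2) lu] e(1) by (auto simp: l_def u_def)
  then have "((\<lambda>t. LBINT s=c..t. f s) has_vector_derivative f t) (at t within {l..u})"
    using e(1) assms(5)
    by (intro interval_integral_FTC2 continuous_on_subset[OF assms(5)]) (auto simp: l_def u_def)
  moreover have "at t within {l..u} = at t"
    using e(1) by (intro at_within_interior) (auto simp: l_def u_def)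
  ultimately show ?thesis by (simp add: has_real_derivative_iff_has_vector_derivative)
qed

lemma DERIV_clock:
  assumes "t \<in> lifespan k a0"
  shows "(clock k a0 has_real_derivative 1 / dilation_sq k a0 t) (at t)"
proof -
  have "continuous_on (lifespan k a0) (\<lambda>s. 1 / dilation_sq k a0 s)"
    by (intro continuous_intros) (use dilation_sq_pos in fastforce)
  from DERIV_interval_integral[OF open_lifespan is_interval_lifespan zero_in_lifespan assms this]
  show ?thesis by (simp add: clock_def[abs_def] zero_ereal_def)
qed

text \<open>The segment with \<open>min\<close> and \<open>max\<close> covers both time directions,
  and the derivative is taken within it because a rate has only one-sided derivatives at endpoints
  of its interval.\<close>

lemma zero_derivative_imp_eq:
  fixes f :: "real \<Rightarrow> real"
  assumes "\<And>x. x \<in> {min c t..max c t} \<Longrightarrow> (f has_real_derivative 0) (at x within {min c t..max c t})"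
  shows "f t = f c"
proof -
  obtain C where "\<forall>x\<in>{min c t..max c t}. f x = C"
    using has_field_derivative_zero_constant[OF _ assms] by (auto simp: convex_real_interval)
  then show ?thesis by (simp add: min_def max_def)
qed

text \<open>Three quantities are shown to be constant, each with the help of the one before: the
  energy, m m' minus its linear candidate, and m^2 minus its quadratic candidate. Uniqueness thus
  needs no Lipschitz argument, although the unknown also occurs under an integral.\<close>

lemma chirp_rate_explicit:
  assumes a: "chirp_rate k a0 I a" and t: "t \<in> I"
  shows "exp (2 * (LBINT \<tau>=0..t. a \<tau>)) = dilation_sq k a0 t"
    and "a t * dilation_sq k a0 t = rate_num k a0 t"
proof -
  have I: "is_interval I" "0 \<in> I" and a0: "a 0 = a0"
    using a by (auto simp: chirp_rate_def)
  define M where "M t = (LBINT \<tau>=ereal 0..t. a \<tau>)" for t :: real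
  have M0: "M 0 = 0" by (simp add: M_def)
  define a' where "a' u = 4 * k * exp (- 4 * M u) - (a u)\<^sup>2" for u
  have Da: "(a has_real_derivative a' u) (at u within S)" if "u \<in> I" "S \<subseteq> I" for u S
  proof -
    have "\<exists>y. (a has_real_derivative y) (at u within I) \<and>
        y + (a u)\<^sup>2 = 4 * k * exp (- 4 * (LBINT \<tau>=0..u. a \<tau>))"
      using a that(1) unfolding chirp_rate_def by simp
    then obtain y where "(a has_real_derivative y) (at u within I)" "y + (a u)\<^sup>2 = 4 * k * exp (- 4 * M u)"
      unfolding M_def zero_ereal_def by metis
    moreover from this(2) have "y = a' u" by (simp add: a'_def)
    ultimately show ?thesis using that(2) by (auto intro: DERIV_subset)
  qed
  have DM: "(M has_real_derivative a u) (at u within {min 0 t..max 0 t})"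
    if "u \<in> {min 0 t..max 0 t}" "t \<in> I" for u t
  proof -
    have J: "{min 0 t..max 0 t} \<subseteq> I" using segment_subset_interval I that by auto
    have "continuous_on {min 0 t..max 0 t} a"
      by (rule DERIV_continuous_on[OF Da]) (use J in auto)
    then have "(M has_vector_derivative a u) (at u within {min 0 t..max 0 t})"
      unfolding M_def[abs_def] using that by (intro interval_integral_FTC2) auto
    then show ?thesis by (simp add: has_real_derivative_iff_has_vector_derivative)
  qed
  let ?c = "a0\<^sup>2 + 4 * k"
  \<comment> \<open>With m = exp M this is m'^2 + 4 k m^(-2), whose value at time 0 is a0^2 + 4
    k.\<close>
  have energy: "(a t)\<^sup>2 * exp (2 * M t) + 4 * k * exp (- 2 * M t) = ?c" if "t \<in> I" for t
  proof -
    let ?J = "{min 0 t..max 0 t}"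
    have J: "?J \<subseteq> I" using segment_subset_interval I that by auto
    have "((\<lambda>u. (a u)\<^sup>2 * exp (2 * M u) + 4 * k * exp (- 2 * M u)) has_real_derivative 0) (at u within ?J)"
      if u: "u \<in> ?J" for u
    proof -
      have E: "exp (- (4 * M u)) * exp (2 * M u) = exp (- (2 * M u))"
        by (simp add: exp_add[symmetric])
      have "((\<lambda>u. (a u)\<^sup>2 * exp (2 * M u) + 4 * k * exp (- 2 * M u)) has_real_derivative
          2 * a u * exp (2 * M u) * (a' u + (a u)\<^sup>2) - 8 * k * a u * exp (- 2 * M u)) (at u within ?J)"
        by (rule derivative_eq_intros Da DM u \<open>t \<in> I\<close> J subsetD[OF J] refl)+
          (simp add: algebra_simps power2_eq_square)
      also have "2 * a u * exp (2 * M u) * (a' u + (a u)\<^sup>2) = 8 * k * a u * (exp (- (4 * M u)) * exp (2 * M u))"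
        by (simp add: a'_def)
      finally show ?thesis unfolding E by simp
    qed
    from zero_derivative_imp_eq[OF this] show ?thesis by (simp add: M0 a0)
  qed
  \<comment> \<open>The derivative of m m' is m'^2 + m m'' = m'^2 + 4 k m^(-2), the constant
    energy.\<close>
  have mom: "a t * exp (2 * M t) = rate_num k a0 t" if "t \<in> I" for t
  proof -
    let ?J = "{min 0 t..max 0 t}"
    have J: "?J \<subseteq> I" using segment_subset_interval I that by auto
    have "((\<lambda>u. a u * exp (2 * M u) - rate_num k a0 u) has_real_derivative 0) (at u within ?J)"
      if u: "u \<in> ?J" for u
    proof -
      have "((\<lambda>u. a u * exp (2 * M u) - rate_num k a0 u) has_real_derivative
          (a' u + (a u)\<^sup>2) * exp (2 * M u) + (a u)\<^sup>2 * exp (2 * M u) - ?c) (at u within ?J)"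
        by (rule derivative_eq_intros Da DM DERIV_rate_num u \<open>t \<in> I\<close> J subsetD[OF J] refl)+
          (simp add: algebra_simps power2_eq_square)
      also have "(a' u + (a u)\<^sup>2) * exp (2 * M u) = 4 * k * exp (- 2 * M u)"
        by (simp add: a'_def exp_add[symmetric])
      also have "4 * k * exp (- 2 * M u) + (a u)\<^sup>2 * exp (2 * M u) - ?c = 0"
        using energy[OF subsetD[OF J u]] by simp
      finally show ?thesis .
    qed
    from zero_derivative_imp_eq[OF this] show ?thesis by (simp add: M0 a0 rate_num_def)
  qed
  have sq: "exp (2 * M t) = dilation_sq k a0 t"
  proof -
    let ?J = "{min 0 t..max 0 t}"
    have J: "?J \<subseteq> I" using segment_subset_interval I t by auto
    have "((\<lambda>u. exp (2 * M u) - dilation_sq k a0 u) has_real_derivative 0) (at u within ?J)"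
      if u: "u \<in> ?J" for u
      by (rule derivative_eq_intros DM DERIV_dilation_sq u t refl)+
        (use mom[of u] J u in \<open>auto simp: algebra_simps\<close>)
    from zero_derivative_imp_eq[OF this] show ?thesis by (simp add: M0)
  qed
  then show "exp (2 * (LBINT \<tau>=0..t. a \<tau>)) = dilation_sq k a0 t"
    by (simp add: M_def zero_ereal_def)
  show "a t * dilation_sq k a0 t = rate_num k a0 t"
    using mom[OF t] sq by simp
qed

text \<open>Along a solution \<open>dilation_sq\<close> equals an exponential, so no solution
  reaches one of its zeros.\<close>

lemma chirp_rate_subset_lifespan:
  assumes "chirp_rate k a0 I a" shows "I \<subseteq> lifespan k a0"
proof (rule subset_lifespan)
  fix t assume "t \<in> I"
  from chirp_rate_explicit(1)[OF assms this, symmetric] show "0 < dilation_sq k a0 t" by simp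
qed (use assms in \<open>auto simp: chirp_rate_def\<close>)

lemma chirp_rate_eq:
  assumes "chirp_rate k a0 I a" "t \<in> I"
  shows "a t = rate_num k a0 t / dilation_sq k a0 t"
  using chirp_rate_explicit(2)[OF assms]
    dilation_sq_pos[OF subsetD[OF chirp_rate_subset_lifespan[OF assms(1)] assms(2)]]
  by (simp add: field_simps)

lemma chirp_rate_integral:
  assumes "chirp_rate k a0 I a" "t \<in> I"
  shows "(LBINT \<tau>=0..t. a \<tau>) = ln (dilation_sq k a0 t) / 2"
  by (simp flip: chirp_rate_explicit(1)[OF assms])

text \<open>With c = a0^2 + 4 k, the derivative of p / q is (c q - 2 p^2) / q^2. Adding (p / q)^2
  leaves (c q - p^2) / q^2, and \<open>dilation_sq_energy\<close> turns the numerator into 4 k. The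
  integral of p / q is (ln q) / 2 because q' = 2 p.\<close>

lemma chirp_rate_lifespan:
  "chirp_rate k a0 (lifespan k a0) (\<lambda>t. rate_num k a0 t / dilation_sq k a0 t)"
  unfolding chirp_rate_def
proof (intro conjI ballI)
  fix t assume t: "t \<in> lifespan k a0"
  let ?q = "dilation_sq k a0" and ?p = "rate_num k a0"
  have J: "{min 0 t..max 0 t} \<subseteq> lifespan k a0"
    using segment_subset_interval is_interval_lifespan t by auto
  have q: "0 < ?q u" if "u \<in> {min 0 t..max 0 t}" for u
    using J that dilation_sq_pos by blast
  have "(LBINT \<tau>=ereal 0..ereal t. ?p \<tau> / ?q \<tau>) = ln (?q t) / 2 - ln (?q 0) / 2"
  proof (rule interval_integral_FTC_finite)
    show "continuous_on {min 0 t..max 0 t} (\<lambda>\<tau>. ?p \<tau> / ?q \<tau>)"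
      using q by (intro continuous_intros) fastforce
    show "((\<lambda>t. ln (?q t) / 2) has_vector_derivative ?p x / ?q x) (at x within {min 0 t..max 0 t})"
      if "min 0 t \<le> x" "x \<le> max 0 t" for x
      using q[of x] that unfolding has_real_derivative_iff_has_vector_derivative[symmetric]
      by (auto intro!: derivative_eq_intros DERIV_dilation_sq)
  qed
  then have "exp (- 4 * (LBINT \<tau>=0..t. ?p \<tau> / ?q \<tau>)) = exp (- 2 * ln (?q t))"
    by (simp add: zero_ereal_def)
  also have "\<dots> = 1 / (?q t)\<^sup>2"
    using dilation_sq_pos[OF t] by (simp add: exp_minus exp_double field_simps)
  finally have E: "exp (- 4 * (LBINT \<tau>=0..t. ?p \<tau> / ?q \<tau>)) = 1 / (?q t)\<^sup>2" .
  have "((\<lambda>t. ?p t / ?q t) has_real_derivative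
      ((a0\<^sup>2 + 4 * k) * ?q t - ?p t * (2 * ?p t)) / (?q t * ?q t)) (at t within lifespan k a0)"
    using dilation_sq_pos[OF t] by (intro DERIV_divide DERIV_dilation_sq DERIV_rate_num) auto
  moreover have "((a0\<^sup>2 + 4 * k) * ?q t - ?p t * (2 * ?p t)) / (?q t * ?q t) + (?p t / ?q t)\<^sup>2
      = 4 * k * (1 / (?q t)\<^sup>2)"
    using dilation_sq_pos[OF t] dilation_sq_energy[of a0 k t] by (simp add: field_simps power2_eq_square)
  ultimately show "\<exists>a'. ((\<lambda>t. ?p t / ?q t) has_real_derivative a') (at t within lifespan k a0) \<and>
      a' + (?p t / ?q t)\<^sup>2 = 4 * k * exp (- 4 * (LBINT \<tau>=0..t. ?p \<tau> / ?q \<tau>))"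
    unfolding E by blast
qed (auto simp: is_interval_lifespan rate_num_def)

lemma maximal_chirp_rate_lifespan:
  "maximal_chirp_rate k a0 (lifespan k a0) (\<lambda>t. rate_num k a0 t / dilation_sq k a0 t)"
  unfolding maximal_chirp_rate_def
  using chirp_rate_lifespan chirp_rate_subset_lifespan chirp_rate_eq by blast

lemma maximal_chirp_rate_eq_lifespan:
  assumes "maximal_chirp_rate k a0 I a" shows "I = lifespan k a0"
  using assms chirp_rate_lifespan[of k a0] chirp_rate_subset_lifespan[of k a0 I a]
  unfolding maximal_chirp_rate_def by blast

text \<open>Removes the nested integrals. Since q = m^2, the exponent d / 2 of m becomes d /
  4.\<close>

lemma psi_explicit:
  assumes a: "chirp_rate k a0 I a" and t: "t \<in> I"
  shows "psi d \<gamma>0 A a t z =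
    of_real (dilation_sq k a0 t powr (- (real d / 4))) * A ((1 / sqrt (dilation_sq k a0 t)) *\<^sub>R z)
    * chirp (rate_num k a0 t / (4 * dilation_sq k a0 t)) z * exp (\<i> * of_real (\<gamma>0 * clock k a0 t))"
proof -
  have q: "0 < dilation_sq k a0 t"
    by (rule dilation_sq_pos[OF subsetD[OF chirp_rate_subset_lifespan[OF a] t]])
  have 1: "exp (- (real d / 2) * (LBINT \<tau>=0..t. a \<tau>)) = dilation_sq k a0 t powr (- (real d / 4))"
    using q by (simp add: chirp_rate_integral[OF a t] powr_def)
  have 2: "exp (- (LBINT \<tau>=0..t. a \<tau>)) = 1 / sqrt (dilation_sq k a0 t)"
    using q by (simp add: chirp_rate_integral[OF a t] exp_minus ln_sqrt[symmetric] inverse_eq_divide)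
  have J: "{min 0 t..max 0 t} \<subseteq> I"
    using segment_subset_interval a t by (auto simp: chirp_rate_def)
  have 3: "(LBINT s=0..t. exp (- 2 * (LBINT \<tau>=0..s. a \<tau>))) = clock k a0 t"
    unfolding clock_def
  proof (rule interval_integral_cong)
    fix s assume "s \<in> einterval (min 0 (ereal t)) (max 0 (ereal t))"
    then have "s \<in> I"
      using J by (auto simp: einterval_def min_def max_def zero_ereal_def split: if_splits)
    then show "exp (- 2 * (LBINT \<tau>=0..s. a \<tau>)) = 1 / dilation_sq k a0 s"
      by (simp add: exp_minus chirp_rate_explicit(1)[OF a] inverse_eq_divide)
  qed
  show ?thesis
    unfolding psi_def 1 2 3 chirp_def by (simp add: chirp_rate_eq[OF a t] mult_ac)
qed

section \<open>Dilations of Lebesgue measure\<close>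

lemma borel_measurable_lebesgue_scaleR:
  "f \<in> borel_measurable lebesgue \<Longrightarrow> (\<lambda>z. f (r *\<^sub>R z)) \<in> borel_measurable lebesgue"
  by (rule measurable_compose[OF lebesgue_measurable_scaling])

text \<open>Null sets, integrals and integrability under dilations are all read off from this one
  identity of measures.\<close>

lemma lebesgue_density_scaleR:
  assumes "r > 0"
  shows "(lebesgue :: 'a::euclidean_space measure)
    = density (distr lebesgue lebesgue (\<lambda>z. r *\<^sub>R z)) (\<lambda>_. ennreal (r ^ DIM('a)))"
proof -
  have "(\<lambda>x::'a. 0 + (\<Sum>j\<in>Basis. (r * (x \<bullet> j)) *\<^sub>R j)) = (\<lambda>z. r *\<^sub>R z)"
    unfolding scaleR_scaleR[symmetric] scaleR_sum_right[symmetric] euclidean_representation by simp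
  then show ?thesis
    using lebesgue_affine_euclidean[of "\<lambda>_. r" "0 :: 'a"] assms by (simp add: ennreal_power)
qed

lemma AE_lebesgue_scaleR:
  assumes "r > 0" "AE z in lebesgue. P (z :: 'a::euclidean_space)"
  shows "AE z in lebesgue. P (r *\<^sub>R z)"
proof -
  have "AE z in density (distr lebesgue lebesgue (\<lambda>z::'a. r *\<^sub>R z)) (\<lambda>_. ennreal (r ^ DIM('a))). P z"
    unfolding lebesgue_density_scaleR[OF assms(1), symmetric] by (rule assms(2))
  then have "AE z in distr lebesgue lebesgue (\<lambda>z::'a. r *\<^sub>R z). P z"
    using assms(1) by (subst (asm) AE_density) auto
  then show ?thesis by (rule AE_distrD[OF lebesgue_measurable_scaling])
qed

lemma integral_lebesgue_scaleR:
  fixes f :: "'a::euclidean_space \<Rightarrow> 'b::{banach, second_countable_topology}"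
  assumes "f \<in> borel_measurable lebesgue" "r > 0"
  shows "(LINT z|lebesgue. f z) = r ^ DIM('a) *\<^sub>R (LINT z|lebesgue. f (r *\<^sub>R z))"
proof -
  have "(LINT z|lebesgue. f z) = (LINT z|density (distr lebesgue lebesgue (\<lambda>z. r *\<^sub>R z)) (\<lambda>_. ennreal (r ^ DIM('a))). f z)"
    by (subst lebesgue_density_scaleR[OF assms(2)]) (rule refl)
  also have "\<dots> = (LINT z|distr lebesgue lebesgue (\<lambda>z. r *\<^sub>R z). r ^ DIM('a) *\<^sub>R f z)"
    using assms by (intro integral_density) auto
  also have "\<dots> = (LINT z|lebesgue. r ^ DIM('a) *\<^sub>R f (r *\<^sub>R z))"
    using assms by (intro integral_distr) auto
  finally show ?thesis by simp
qed

lemma integrable_lebesgue_scaleR: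
  fixes f :: "'a::euclidean_space \<Rightarrow> 'b::{banach, second_countable_topology}"
  assumes f: "integrable lebesgue f" and r: "r > 0"
  shows "integrable lebesgue (\<lambda>z. f (r *\<^sub>R z))"
proof -
  have "integrable (density (distr lebesgue lebesgue (\<lambda>z. r *\<^sub>R z)) (\<lambda>_. ennreal (r ^ DIM('a)))) f"
    using f lebesgue_density_scaleR[OF r, where 'a = 'a] by simp
  then have "integrable (distr lebesgue lebesgue (\<lambda>z. r *\<^sub>R z)) (\<lambda>z. r ^ DIM('a) *\<^sub>R f z)"
    using f r by (subst (asm) integrable_density) auto
  then have "integrable lebesgue (\<lambda>z. r ^ DIM('a) *\<^sub>R f (r *\<^sub>R z))"
    using f by (subst (asm) integrable_distr_eq) auto
  then have "integrable lebesgue (\<lambda>z. (1 / r ^ DIM('a)) *\<^sub>R (r ^ DIM('a) *\<^sub>R f (r *\<^sub>R z)))"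
    by (rule integrable_scaleR_right)
  then show ?thesis using r by simp
qed

lemma integrable_lebesgue_compact_support:
  fixes f :: "'a::euclidean_space \<Rightarrow> complex"
  assumes "continuous_on UNIV f" "\<And>z. z \<notin> cball 0 R \<Longrightarrow> f z = 0"
  shows "integrable lebesgue f"
proof -
  have "integrable lborel (\<lambda>z. indicat_real (cball 0 R) z *\<^sub>R f z)"
    by (rule borel_integrable_compact) (auto intro: continuous_on_subset[OF assms(1)])
  moreover have "(\<lambda>z. indicat_real (cball 0 R) z *\<^sub>R f z) = f"
    using assms(2) by (auto simp: indicator_def fun_eq_iff)
  ultimately have "integrable lborel f" by simp
  then show ?thesis by (simp add: integrable_completion)
qed

section \<open>The essential supremum norm\<close>

lemma Linf_norm_AE: "AE z in lebesgue. ereal (norm (f z)) \<le> Linf_norm f"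
  unfolding Linf_norm_def by (rule esssup_AE)

lemma Linf_norm_leI:
  "f \<in> borel_measurable lebesgue \<Longrightarrow> AE z in lebesgue. ereal (norm (f z)) \<le> c \<Longrightarrow> Linf_norm f \<le> c"
  unfolding Linf_norm_def by (rule esssup_I) auto

lemma Linf_norm_nonneg: "0 \<le> Linf_norm (f :: 'a::euclidean_space \<Rightarrow> complex)"
proof -
  have "esssup lebesgue (\<lambda>z::'a. 0 :: ereal) \<le> Linf_norm f"
    unfolding Linf_norm_def by (rule esssup_mono) auto
  then show ?thesis by (simp add: esssup_const)
qed

lemma Linf_norm_cases:
  assumes "Linf f"
  obtains N where "0 \<le> N" "Linf_norm f = ereal N" "AE z in lebesgue. norm (f z) \<le> N"
proof (cases "Linf_norm f")
  case (real N)
  with Linf_norm_AE[of f] Linf_norm_nonneg[of f] that show ?thesis by auto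
qed (use assms Linf_norm_nonneg[of f] in \<open>auto simp: Linf_def\<close>)

lemma Linf_norm_triangle: "Linf_norm (\<lambda>z. f z + g z) \<le> Linf_norm f + Linf_norm g"
  if "f \<in> borel_measurable lebesgue" "g \<in> borel_measurable lebesgue"
proof (rule Linf_norm_leI)
  show "AE z in lebesgue. ereal (norm (f z + g z)) \<le> Linf_norm f + Linf_norm g"
    using Linf_norm_AE[of f] Linf_norm_AE[of g]
  proof eventually_elim
    case (elim z)
    have "ereal (norm (f z + g z)) \<le> ereal (norm (f z)) + ereal (norm (g z))"
      by (simp add: norm_triangle_ineq)
    also have "\<dots> \<le> Linf_norm f + Linf_norm g" using elim by (rule add_mono)
    finally show ?case .
  qed
qed (use that in auto)

text \<open>One inequality, for all \<open>f\<close> and \<open>r\<close>, suffices: it is applied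
  again to the dilated function with ratio 1 / r.\<close>

lemma Linf_norm_scaleR:
  fixes f :: "'a::euclidean_space \<Rightarrow> complex"
  assumes "f \<in> borel_measurable lebesgue" "r > 0"
  shows "Linf_norm (\<lambda>z. f (r *\<^sub>R z)) = Linf_norm f"
proof -
  have le: "Linf_norm (\<lambda>z. f (r *\<^sub>R z)) \<le> Linf_norm f"
    if "f \<in> borel_measurable lebesgue" "r > 0" for f :: "'a \<Rightarrow> complex" and r
    using that by (intro Linf_norm_leI borel_measurable_lebesgue_scaleR AE_lebesgue_scaleR Linf_norm_AE)
  show ?thesis
    using le[OF assms] le[of "\<lambda>z. f (r *\<^sub>R z)" "1 / r"] assms
    by (auto intro!: antisym borel_measurable_lebesgue_scaleR)
qed

lemma Linf_norm_cmult:
  assumes "\<And>z. norm (g z) = c * norm (f z)" "c > 0"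
  shows "Linf_norm g = ereal c * Linf_norm f"
  unfolding Linf_norm_def assms(1) using esssup_cmult[OF assms(2), of lebesgue "\<lambda>z. ereal (norm (f z))"]
  by simp

lemma Linf_mult_integrable:
  assumes "Linf A" "integrable lebesgue g"
  shows "integrable lebesgue (\<lambda>z. A z * g z)"
proof -
  obtain N where N: "0 \<le> N" "AE z in lebesgue. norm (A z) \<le> N"
    using Linf_norm_cases[OF assms(1)] by metis
  show ?thesis
  proof (rule Bochner_Integration.integrable_bound)
    show "integrable lebesgue (\<lambda>z. of_real N * g z)" using assms(2) by simp
    show "AE z in lebesgue. norm (A z * g z) \<le> norm (of_real N * g z)"
      using N(2) by eventually_elim (use N(1) in \<open>auto simp: norm_mult intro: mult_right_mono\<close>)
    have "A \<in> borel_measurable lebesgue" using assms(1) by (simp add: Linf_def)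
    then show "(\<lambda>z. A z * g z) \<in> borel_measurable lebesgue"
      using borel_measurable_integrable[OF assms(2)] by (rule borel_measurable_times)
  qed
qed

section \<open>Continuity of dilations in the mean\<close>

lemma norm_norm_diff_le_double:
  fixes a b :: complex
  shows "norm a \<le> c \<Longrightarrow> norm b \<le> c \<Longrightarrow> norm (norm (a - b)) \<le> 2 * c"
  using norm_triangle_ineq4[of a b] by simp

text \<open>First \<open>g\<close> is clipped in value and in space, at small cost by dominated
  convergence; then the clipped \<open>g\<close> is approximated by equally clipped continuous
  functions. The continuous approximants of \<open>g\<close> converge only almost everywhere, and
  the clipping supplies their common integrable bound.\<close>

lemma integrable_approximate_compact_support:
  fixes g :: "'a::euclidean_space \<Rightarrow> complex"
  assumes g: "integrable lebesgue g" and "e > 0"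
  obtains h R where "continuous_on UNIV h" "\<And>z. z \<notin> cball 0 R \<Longrightarrow> h z = 0"
    "(LINT z|lebesgue. norm (g z - h z)) < e"
proof -
  \<comment> \<open>\<open>T n\<close> is the radial retraction onto the disc of radius n + 1, and
    \<open>cut n\<close> falls from 1 on the ball of radius n to 0 outside the ball of radius n +
    1.\<close>
  define T where "T n u = (real (Suc n) / max (real (Suc n)) (norm u)) *\<^sub>R u" for n and u :: complex
  define cut where "cut n z = max 0 (min 1 (real n + 1 - norm z))" for n and z :: 'a
  have norm_T: "norm (T n u) = real (Suc n) / max (real (Suc n)) (norm u) * norm u" for n u
    by (simp add: T_def)
  have T_le: "norm (T n u) \<le> norm u" for n u
    unfolding norm_T by (intro mult_left_le_one_le) auto
  have T_le': "norm (T n u) \<le> real (Suc n)" for n u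
    unfolding norm_T by (simp add: divide_simps mult_left_mono del: of_nat_Suc)
  have cont_T: "continuous_on UNIV (T n)" for n
    unfolding T_def[abs_def] by (intro continuous_intros) (auto simp: max_def)
  have cont_cut: "continuous_on UNIV (cut n)" for n
    unfolding cut_def[abs_def] by (intro continuous_intros)
  have cut: "0 \<le> cut n z" "cut n z \<le> 1" for n z by (auto simp: cut_def)
  have cut0: "cut n z = 0" if "z \<notin> cball 0 (real n + 1)" for n z
    using that by (simp add: cut_def)
  define G where "G n u z = cut n z *\<^sub>R T n u" for n u z
  have G_le: "norm (G n u z) \<le> norm u" for n u z
    using mult_mono[OF cut(2)[of n z] T_le[of n u]] cut(1)[of n z] by (simp add: G_def)
  have G_le': "norm (G n u z) \<le> real (Suc n) * indicator (cball 0 (real n + 1)) z" for n u z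
    using mult_mono[OF cut(2)[of n z] T_le'[of n u]] cut[of n z] cut0[of z n]
    by (auto simp: G_def indicator_def)
  have [measurable]: "g \<in> borel_measurable lebesgue" using g by auto
  have meas_G: "(\<lambda>z. G n (f z) z) \<in> borel_measurable lebesgue"
    if "f \<in> borel_measurable lebesgue" for n f
    unfolding G_def
    using measurable_compose[OF that borel_measurable_continuous_onI[OF cont_T]]
      borel_measurable_continuous_onI[OF cont_cut]
    by (intro borel_measurable_scaleR) (auto intro: measurable_completion)
  have meas_d: "(\<lambda>z. norm (g z - G n (g z) z)) \<in> borel_measurable lebesgue" for n
    using meas_G[of g n] by simp
  have "(\<lambda>n. LINT z|lebesgue. norm (g z - G n (g z) z)) \<longlonglongrightarrow> (LINT z|(lebesgue :: 'a measure). 0)"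
  proof (rule integral_dominated_convergence)
    show "integrable lebesgue (\<lambda>z. 2 * norm (g z))" using g by simp
    show "AE z in lebesgue. norm (norm (g z - G n (g z) z)) \<le> 2 * norm (g z)" for n
      by (intro AE_I2 norm_norm_diff_le_double G_le order_refl)
    show "AE z in lebesgue. (\<lambda>n. norm (g z - G n (g z) z)) \<longlonglongrightarrow> 0"
    proof (rule AE_I2)
      fix z
      \<comment> \<open>Beyond this index neither clip acts at \<open>z\<close>, so the difference
        is exactly 0.\<close>
      obtain N where N: "max (norm z) (norm (g z)) < real N" using reals_Archimedean2 by blast
      have "norm (g z - G n (g z) z) = 0" if "n \<ge> N" for n
      proof -
        have "norm z \<le> real n" "norm (g z) \<le> real (Suc n)" using N that by auto
        then show ?thesis by (simp add: G_def T_def cut_def max_absorb1)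
      qed
      then show "(\<lambda>n. norm (g z - G n (g z) z)) \<longlonglongrightarrow> 0"
        by (intro tendsto_eventually) (auto simp: eventually_sequentially)
    qed
  qed (simp_all add: meas_d)
  then obtain n where n: "(LINT z|lebesgue. norm (g z - G n (g z) z)) < e / 2"
    using \<open>e > 0\<close> order_tendstoD(2)[of _ "0 :: real" sequentially "e / 2"]
    by (auto simp: eventually_sequentially)
  have "g measurable_on UNIV" by (rule lebesgue_measurable_imp_measurable_on) auto
  then obtain N f where N: "negligible N" and f: "\<And>m. continuous_on UNIV (f m)"
    "\<And>x. x \<notin> N \<Longrightarrow> (\<lambda>m. f m x) \<longlonglongrightarrow> g x"
    unfolding measurable_on_def by auto
  have f_meas: "f m \<in> borel_measurable lebesgue" for m
    using borel_measurable_continuous_onI[OF f(1)] by (auto intro: measurable_completion)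
  have contG: "continuous_on UNIV (\<lambda>z. G n (f m z) z)" for m
    unfolding G_def
    by (intro continuous_intros cont_cut continuous_on_compose2[OF cont_T f(1)]) auto
  have intG: "integrable lebesgue (\<lambda>z. G n (g z) z)"
    using g by (rule Bochner_Integration.integrable_bound) (auto intro!: meas_G G_le)
  have intGf: "integrable lebesgue (\<lambda>z. G n (f m z) z)" for m
    by (rule integrable_lebesgue_compact_support[OF contG, of "real n + 1"]) (simp add: G_def cut0)
  have meas_d': "(\<lambda>z. norm (G n (g z) z - G n (f m z) z)) \<in> borel_measurable lebesgue" for m
    using meas_G[of g n] meas_G[OF f_meas, of n m] by simp
  have "(\<lambda>m. LINT z|lebesgue. norm (G n (g z) z - G n (f m z) z)) \<longlonglongrightarrow> (LINT z|(lebesgue :: 'a measure). 0)"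
  proof (rule integral_dominated_convergence)
    show "integrable lebesgue (\<lambda>z. 2 * (real (Suc n) * indicator (cball 0 (real n + 1)) (z :: 'a)))"
      using emeasure_lborel_cball_finite[of "0 :: 'a" "real n + 1"]
      by (intro integrable_mult_right integrable_real_indicator) auto
    show "AE z in lebesgue. norm (norm (G n (g z) z - G n (f m z) z))
        \<le> 2 * (real (Suc n) * indicator (cball 0 (real n + 1)) z)" for m
      by (intro AE_I2 norm_norm_diff_le_double G_le')
    have "AE z in lebesgue. z \<notin> N"
      using N by (auto simp: negligible_iff_null_sets intro: AE_not_in)
    then show "AE z in lebesgue. (\<lambda>m. norm (G n (g z) z - G n (f m z) z)) \<longlonglongrightarrow> 0"
    proof eventually_elim
      case (elim z)
      have "(\<lambda>m. T n (f m z)) \<longlonglongrightarrow> T n (g z)"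
        using cont_T[of n] f(2)[OF elim] by (auto simp: continuous_on_eq_continuous_at intro: isCont_tendsto_compose)
      then have "(\<lambda>m. norm (G n (g z) z - G n (f m z) z)) \<longlonglongrightarrow> norm (G n (g z) z - G n (g z) z)"
        unfolding G_def by (intro tendsto_intros)
      then show ?case by simp
    qed
  qed (simp_all add: meas_d')
  then obtain m where m: "(LINT z|lebesgue. norm (G n (g z) z - G n (f m z) z)) < e / 2"
    using \<open>e > 0\<close> order_tendstoD(2)[of _ "0 :: real" sequentially "e / 2"]
    by (auto simp: eventually_sequentially)
  have "(LINT z|lebesgue. norm (g z - G n (f m z) z))
      \<le> (LINT z|lebesgue. norm (g z - G n (g z) z) + norm (G n (g z) z - G n (f m z) z))"
    using g intG intGf by (intro integral_mono) (auto intro: norm_diff_triangle_le)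
  also have "\<dots> = (LINT z|lebesgue. norm (g z - G n (g z) z)) + (LINT z|lebesgue. norm (G n (g z) z - G n (f m z) z))"
    using g intG intGf by (intro Bochner_Integration.integral_add) auto
  also have "\<dots> < e" using n m by simp
  finally show ?thesis
    using that[OF contG, of "real n + 1" m] by (simp add: G_def cut0)
qed

text \<open>Dominated convergence settles continuous \<open>h\<close> with compact support, and
  these approximate \<open>g\<close>. A dilation by s multiplies an L1 error by s^(-D), which stays
  bounded as long as the ratios keep away from 0.\<close>

lemma dilation_continuous_in_L1:
  fixes g :: "'a::euclidean_space \<Rightarrow> complex"
  assumes g: "integrable lebesgue g" and r: "r \<longlonglongrightarrow> r0" "\<And>n. r n > 0" "r0 > 0"
  shows "(\<lambda>n. LINT z|lebesgue. norm (g (r n *\<^sub>R z) - g (r0 *\<^sub>R z))) \<longlonglongrightarrow> 0"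
proof -
  obtain \<delta> where \<delta>: "\<delta> > 0" "\<And>n. \<delta> \<le> r n" "\<delta> \<le> r0"
  proof -
    obtain N where N: "\<And>n. n \<ge> N \<Longrightarrow> r n > r0 / 2"
      using order_tendstoD(1)[OF r(1), of "r0 / 2"] r(3) by (auto simp: eventually_sequentially)
    \<comment> \<open>A lower bound for all ratios at once: the tail lies above r0 / 2, and the
      finitely many others are positive.\<close>
    define \<delta> where "\<delta> = Min (insert (r0 / 2) (r ` {..N}))"
    have "\<delta> \<le> r n" for n
    proof (cases "n \<le> N")
      case True then show ?thesis unfolding \<delta>_def by (intro Min_le) auto
    next
      case False
      have "\<delta> \<le> r0 / 2" unfolding \<delta>_def by (intro Min_le) auto
      with N[of n] False show ?thesis by auto
    qed
    moreover have "\<delta> \<le> r0 / 2" "\<delta> > 0" unfolding \<delta>_def using r by auto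
    ultimately show ?thesis using that[of \<delta>] r(3) by force
  qed
  have compact_case: "(\<lambda>n. LINT z|lebesgue. norm (h (r n *\<^sub>R z) - h (r0 *\<^sub>R z))) \<longlonglongrightarrow> 0"
    if h: "continuous_on UNIV h" "\<And>z. z \<notin> cball 0 R \<Longrightarrow> h z = 0" for h :: "'a \<Rightarrow> complex" and R
  proof -
    have "compact (h ` cball 0 R)" using h by (intro compact_continuous_image continuous_on_subset[OF h(1)]) auto
    then obtain B where "\<forall>y\<in>h ` cball 0 R. norm y \<le> B"
      using compact_imp_bounded bounded_iff by metis
    then have B: "norm (h z) \<le> B" if "z \<in> cball 0 R" for z
      using that by blast
    have hB: "norm (h (s *\<^sub>R z)) \<le> \<bar>B\<bar> * indicator (cball 0 (R / \<delta>)) z" if "s \<ge> \<delta>" for s z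
    proof (cases "s *\<^sub>R z \<in> cball 0 R")
      case True
      then have "norm z * \<delta> \<le> R" using that \<delta>(1) mult_right_mono[OF that, of "norm z"] by (simp add: mult.commute)
      then have "z \<in> cball 0 (R / \<delta>)" using \<delta>(1) by (simp add: field_simps)
      then show ?thesis using B[OF True] by simp
    qed (simp add: h)
    have meas: "(\<lambda>z. h (s *\<^sub>R z)) \<in> borel_measurable lebesgue" for s
      using borel_measurable_continuous_onI[OF h(1)]
      by (intro borel_measurable_lebesgue_scaleR) (auto intro: measurable_completion)
    have meas_d: "(\<lambda>z. norm (h (r n *\<^sub>R z) - h (r0 *\<^sub>R z))) \<in> borel_measurable lebesgue" for n
      using meas[of "r n"] meas[of r0] by simp
    have "(\<lambda>n. LINT z|lebesgue. norm (h (r n *\<^sub>R z) - h (r0 *\<^sub>R z))) \<longlonglongrightarrow> (LINT z|(lebesgue :: 'a measure). 0)"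
    proof (rule integral_dominated_convergence)
      show "integrable lebesgue (\<lambda>z. 2 * (\<bar>B\<bar> * indicator (cball 0 (R / \<delta>)) (z :: 'a)))"
        using emeasure_lborel_cball_finite[of "0 :: 'a" "R / \<delta>"]
        by (intro integrable_mult_right integrable_real_indicator) auto
      show "AE z in lebesgue. norm (norm (h (r n *\<^sub>R z) - h (r0 *\<^sub>R z)))
          \<le> 2 * (\<bar>B\<bar> * indicator (cball 0 (R / \<delta>)) z)" for n
        by (intro AE_I2 norm_norm_diff_le_double hB \<delta>)
      show "AE z in lebesgue. (\<lambda>n. norm (h (r n *\<^sub>R z) - h (r0 *\<^sub>R z))) \<longlonglongrightarrow> 0"
      proof (rule AE_I2)
        fix z
        have "(\<lambda>n. h (r n *\<^sub>R z)) \<longlonglongrightarrow> h (r0 *\<^sub>R z)"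
          using h(1) by (intro isCont_tendsto_compose[of _ h] tendsto_intros r)
            (auto simp: continuous_on_eq_continuous_at)
        then show "(\<lambda>n. norm (h (r n *\<^sub>R z) - h (r0 *\<^sub>R z))) \<longlonglongrightarrow> 0"
          by (intro tendsto_norm_zero LIM_zero)
      qed
    qed (simp_all add: meas_d)
    then show ?thesis by simp
  qed
  let ?D = "DIM('a)"
  show ?thesis
  proof (rule LIMSEQ_I)
    fix e :: real assume "e > 0"
    \<comment> \<open>Dilation by s >= \<delta> enlarges the error at most by \<delta>^(-D), which
      leaves e / 4; three such quarters stay below e.\<close>
    let ?e = "e * \<delta> ^ ?D / 4"
    obtain h R where h: "continuous_on UNIV h" "\<And>z. z \<notin> cball 0 R \<Longrightarrow> h z = 0"
      "(LINT z|lebesgue. norm (g z - h z)) < ?e"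
      using integrable_approximate_compact_support[OF g, of ?e] \<open>e > 0\<close> \<delta>(1) by auto
    have inth: "integrable lebesgue h" by (rule integrable_lebesgue_compact_support[OF h(1,2)])
    have close: "(LINT z|lebesgue. norm (g (s *\<^sub>R z) - h (s *\<^sub>R z))) \<le> e / 4" if "s \<ge> \<delta>" for s
    proof -
      have s: "s > 0" using that \<delta>(1) by simp
      have I: "0 \<le> (LINT z|lebesgue. norm (g (s *\<^sub>R z) - h (s *\<^sub>R z)))" by simp
      have "\<delta> ^ ?D * (LINT z|lebesgue. norm (g (s *\<^sub>R z) - h (s *\<^sub>R z)))
          \<le> s ^ ?D * (LINT z|lebesgue. norm (g (s *\<^sub>R z) - h (s *\<^sub>R z)))"
        using that \<delta>(1) by (intro mult_right_mono[OF power_mono I]) auto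
      also have "\<dots> = (LINT z|lebesgue. norm (g z - h z))"
        using g inth s by (subst integral_lebesgue_scaleR[of "\<lambda>z. norm (g z - h z)" s]) auto
      also have "\<dots> \<le> \<delta> ^ ?D * (e / 4)" using h(3) by (simp add: mult.commute)
      finally show ?thesis using \<delta>(1) by (simp add: mult_le_cancel_left)
    qed
    have "\<forall>\<^sub>F n in sequentially. (LINT z|lebesgue. norm (h (r n *\<^sub>R z) - h (r0 *\<^sub>R z))) < e / 4"
      using \<open>e > 0\<close> by (intro order_tendstoD(2)[OF compact_case[OF h(1,2)]]) auto
    then obtain N where N: "\<And>n. n \<ge> N \<Longrightarrow> (LINT z|lebesgue. norm (h (r n *\<^sub>R z) - h (r0 *\<^sub>R z))) < e / 4"
      by (auto simp: eventually_sequentially)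
    have "(LINT z|lebesgue. norm (g (r n *\<^sub>R z) - g (r0 *\<^sub>R z))) < e" if "n \<ge> N" for n
    proof -
      have i: "integrable lebesgue (\<lambda>z. norm (f (s *\<^sub>R z) - f' (s' *\<^sub>R z)))"
        if "f \<in> {g, h}" "f' \<in> {g, h}" "s > 0" "s' > 0" for f f' s s'
        using that g inth
        by (intro integrable_norm Bochner_Integration.integrable_diff integrable_lebesgue_scaleR) auto
      have "(LINT z|lebesgue. norm (g (r n *\<^sub>R z) - g (r0 *\<^sub>R z)))
        \<le> (LINT z|lebesgue. norm (g (r n *\<^sub>R z) - h (r n *\<^sub>R z)) + norm (h (r n *\<^sub>R z) - h (r0 *\<^sub>R z))
            + norm (g (r0 *\<^sub>R z) - h (r0 *\<^sub>R z)))"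
      proof (intro integral_mono Bochner_Integration.integrable_add i)
        show "norm (g (r n *\<^sub>R z) - g (r0 *\<^sub>R z)) \<le> norm (g (r n *\<^sub>R z) - h (r n *\<^sub>R z))
            + norm (h (r n *\<^sub>R z) - h (r0 *\<^sub>R z)) + norm (g (r0 *\<^sub>R z) - h (r0 *\<^sub>R z))" for z
          by norm
      qed (use r in auto)
      also have "\<dots> = (LINT z|lebesgue. norm (g (r n *\<^sub>R z) - h (r n *\<^sub>R z)))
          + (LINT z|lebesgue. norm (h (r n *\<^sub>R z) - h (r0 *\<^sub>R z)))
          + (LINT z|lebesgue. norm (g (r0 *\<^sub>R z) - h (r0 *\<^sub>R z)))"
        using i r by (subst Bochner_Integration.integral_add; simp)+
      also have "\<dots> < e"
        using close[OF \<delta>(2)[of n]] close[OF \<delta>(3)] N[OF that] \<open>e > 0\<close> by linarith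
      finally show ?thesis .
    qed
    then show "\<exists>N. \<forall>n\<ge>N. norm ((LINT z|lebesgue. norm (g (r n *\<^sub>R z) - g (r0 *\<^sub>R z))) - 0) < e"
      by (intro exI[of _ N]) simp
  qed
qed

section \<open>Weak-* and norm continuity of modulated dilations\<close>

text \<open>At each time \<open>psi\<close> has this form, with amplitude and phase gathered in
  \<open>\<alpha>\<close>. Continuity in time reduces to continuity of the three parameters.\<close>

definition modulate ::
    "complex \<Rightarrow> real \<Rightarrow> real \<Rightarrow> (real \<times> (real^'n) \<Rightarrow> complex) \<Rightarrow> real \<times> (real^'n) \<Rightarrow> complex" where
  "modulate \<alpha> r p A z = \<alpha> * A (r *\<^sub>R z) * chirp p z"

lemma borel_measurable_chirp [measurable]: "chirp p \<in> borel_measurable lebesgue"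
  using borel_measurable_continuous_onI[OF Ck_imp_continuous_on[OF Ck_chirp[of 0 p]]]
  by (auto intro: measurable_completion)

lemma borel_measurable_modulate:
  assumes "A \<in> borel_measurable lebesgue"
  shows "modulate \<alpha> r p A \<in> borel_measurable lebesgue"
proof -
  have [measurable]: "(\<lambda>z. A (r *\<^sub>R z)) \<in> borel_measurable lebesgue"
    by (rule borel_measurable_lebesgue_scaleR[OF assms])
  show ?thesis unfolding modulate_def[abs_def] by measurable
qed

lemma Linf_norm_modulate:
  assumes "A \<in> borel_measurable lebesgue" "\<alpha> \<noteq> 0" "r > 0"
  shows "Linf_norm (modulate \<alpha> r p A) = ereal (norm \<alpha>) * Linf_norm A"
proof -
  have "Linf_norm (modulate \<alpha> r p A) = ereal (norm \<alpha>) * Linf_norm (\<lambda>z. A (r *\<^sub>R z))"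
    by (rule Linf_norm_cmult) (use assms(2) in \<open>auto simp: modulate_def norm_mult\<close>)
  then show ?thesis using Linf_norm_scaleR[OF assms(1,3)] by simp
qed

lemma Linf_modulate:
  assumes "Linf A" "\<alpha> \<noteq> 0" "r > 0"
  shows "Linf (modulate \<alpha> r p A)"
proof -
  obtain N where "Linf_norm A = ereal N" using Linf_norm_cases[OF assms(1)] by metis
  then show ?thesis
    using assms by (auto simp: Linf_def Linf_norm_modulate borel_measurable_modulate)
qed

lemma chirp_add: "chirp (p + q) z = chirp p z * chirp q z"
  by (simp add: chirp_def algebra_simps exp_add)

lemma chirp_scaleR: "chirp p (r *\<^sub>R z) = chirp (p * r\<^sup>2) z"
  by (simp add: chirp_def hyp_scaleR mult_ac)

lemma tendsto_chirp: "(p \<longlongrightarrow> p0) F \<Longrightarrow> ((\<lambda>x. chirp (p x) z) \<longlongrightarrow> chirp p0 z) F"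
  unfolding chirp_def by (intro tendsto_intros)

text \<open>The parameters move one after the other: the chirp with the dilation frozen, by
  dominated convergence, then the dilation, where \<open>A\<close> and the chirp are bounded and
  \<open>dilation_continuous_in_L1\<close> applies.\<close>

lemma tendsto_chirp_dilation_integral:
  assumes A: "Linf A" and g: "integrable lebesgue g"
    and r: "r \<longlonglongrightarrow> r0" "\<And>n. r n > 0" "r0 > 0" and p: "p \<longlonglongrightarrow> p0"
  shows "(\<lambda>n. LINT z|lebesgue. A z * (chirp (p n) z * g (r n *\<^sub>R z)))
    \<longlonglongrightarrow> (LINT z|lebesgue. A z * (chirp p0 z * g (r0 *\<^sub>R z)))"
proof -
  obtain N where N: "0 \<le> N" "AE z in lebesgue. norm (A z) \<le> N"
    using Linf_norm_cases[OF A] by metis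
  have [measurable]: "A \<in> borel_measurable lebesgue" using A by (simp add: Linf_def)
  have ig: "integrable lebesgue (\<lambda>z. g (s *\<^sub>R z))" if "s > 0" for s
    using g that by (rule integrable_lebesgue_scaleR)
  have gm: "(\<lambda>z. g (s *\<^sub>R z)) \<in> borel_measurable lebesgue" if "s > 0" for s
    using ig[OF that] by simp
  have cg: "integrable lebesgue (\<lambda>z. chirp q z * g (s *\<^sub>R z))" if "s > 0" for s q
    by (rule Bochner_Integration.integrable_bound[OF ig[OF that]])
      (use gm[OF that] in \<open>auto simp: norm_mult\<close>)
  have Acg: "integrable lebesgue (\<lambda>z. A z * (chirp q z * g (s *\<^sub>R z)))" if "s > 0" for s q
    by (rule Linf_mult_integrable[OF A cg[OF that]])
  have "(\<lambda>n. LINT z|lebesgue. A z * (chirp (p n) z * g (r0 *\<^sub>R z)))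
    \<longlonglongrightarrow> (LINT z|lebesgue. A z * (chirp p0 z * g (r0 *\<^sub>R z)))"
  proof (rule integral_dominated_convergence)
    show "integrable lebesgue (\<lambda>z. N * norm (g (r0 *\<^sub>R z)))"
      using ig[OF r(3)] by simp
    show "AE z in lebesgue. norm (A z * (chirp (p n) z * g (r0 *\<^sub>R z))) \<le> N * norm (g (r0 *\<^sub>R z))" for n
      using N(2) by eventually_elim (auto simp: norm_mult intro: mult_right_mono)
    show "AE z in lebesgue. (\<lambda>n. A z * (chirp (p n) z * g (r0 *\<^sub>R z))) \<longlonglongrightarrow> A z * (chirp p0 z * g (r0 *\<^sub>R z))"
      by (intro AE_I2 tendsto_intros tendsto_chirp p)
  qed (use Acg[OF r(3)] in auto)
  moreover have "(\<lambda>n. (LINT z|lebesgue. A z * (chirp (p n) z * g (r n *\<^sub>R z)))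
      - (LINT z|lebesgue. A z * (chirp (p n) z * g (r0 *\<^sub>R z)))) \<longlonglongrightarrow> 0"
  proof (rule Lim_null_comparison)
    show "\<forall>\<^sub>F n in sequentially. norm ((LINT z|lebesgue. A z * (chirp (p n) z * g (r n *\<^sub>R z)))
      - (LINT z|lebesgue. A z * (chirp (p n) z * g (r0 *\<^sub>R z))))
      \<le> N * (LINT z|lebesgue. norm (g (r n *\<^sub>R z) - g (r0 *\<^sub>R z)))"
    proof (rule always_eventually, rule allI)
      fix n
      have "(LINT z|lebesgue. A z * (chirp (p n) z * g (r n *\<^sub>R z)))
          - (LINT z|lebesgue. A z * (chirp (p n) z * g (r0 *\<^sub>R z)))
        = (LINT z|lebesgue. A z * (chirp (p n) z * g (r n *\<^sub>R z)) - A z * (chirp (p n) z * g (r0 *\<^sub>R z)))"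
        by (rule Bochner_Integration.integral_diff[symmetric]) (intro Acg r)+
      also have "norm \<dots> \<le> (LINT z|lebesgue. norm (A z * (chirp (p n) z * g (r n *\<^sub>R z)) - A z * (chirp (p n) z * g (r0 *\<^sub>R z))))"
        by (rule integral_norm_bound)
      also have "\<dots> \<le> (LINT z|lebesgue. N * norm (g (r n *\<^sub>R z) - g (r0 *\<^sub>R z)))"
      proof (rule integral_mono_AE)
        show "AE z in lebesgue. norm (A z * (chirp (p n) z * g (r n *\<^sub>R z)) - A z * (chirp (p n) z * g (r0 *\<^sub>R z)))
          \<le> N * norm (g (r n *\<^sub>R z) - g (r0 *\<^sub>R z))"
          using N(2) by eventually_elim
            (auto simp: norm_mult right_diff_distrib[symmetric] intro: mult_right_mono)
      qed (use ig r Acg in auto)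
      finally show "norm ((LINT z|lebesgue. A z * (chirp (p n) z * g (r n *\<^sub>R z)))
          - (LINT z|lebesgue. A z * (chirp (p n) z * g (r0 *\<^sub>R z))))
        \<le> N * (LINT z|lebesgue. norm (g (r n *\<^sub>R z) - g (r0 *\<^sub>R z)))" by simp
    qed
    show "(\<lambda>n. N * (LINT z|lebesgue. norm (g (r n *\<^sub>R z) - g (r0 *\<^sub>R z)))) \<longlonglongrightarrow> 0"
      by (rule tendsto_mult_right_zero[OF dilation_continuous_in_L1[OF g r]])
  qed
  ultimately show ?thesis using tendsto_add by fastforce
qed

lemma weak_star_continuous_modulate:
  fixes A :: "real \<times> (real^'n) \<Rightarrow> complex"
  assumes A: "Linf A" and c: "continuous_on I \<alpha>" "continuous_on I r" "continuous_on I p"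
    and nz: "\<And>t. t \<in> I \<Longrightarrow> \<alpha> t \<noteq> 0" "\<And>t. t \<in> I \<Longrightarrow> r t > 0"
  shows "weak_star_continuous_in_Linf I (\<lambda>t. modulate (\<alpha> t) (r t) (p t) A)"
  unfolding weak_star_continuous_in_Linf_def
proof (intro conjI ballI allI impI)
  fix g :: "real \<times> (real^'n) \<Rightarrow> complex" assume g: "integrable lebesgue g"
  have gm: "g \<in> borel_measurable lebesgue" using g by simp
  let ?D = "DIM(real \<times> (real^'n))"
  \<comment> \<open>After the substitution \<open>A\<close> no longer depends on time: the inverse
    dilation and the rescaled chirp act on \<open>g\<close>, and the Jacobian joins the
    prefactor.\<close>
  define H where "H s q = (LINT z|lebesgue. A z * (chirp q z * g (s *\<^sub>R z)))" for s q
  have eq: "(LINT z|lebesgue. modulate (\<alpha> t) (r t) (p t) A z * g z)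
      = \<alpha> t * of_real ((1 / r t) ^ ?D) * H (1 / r t) (p t / (r t)\<^sup>2)" if "t \<in> I" for t
  proof -
    have m: "(\<lambda>z. modulate (\<alpha> t) (r t) (p t) A z * g z) \<in> borel_measurable lebesgue"
      using A gm by (intro borel_measurable_times borel_measurable_modulate) (auto simp: Linf_def)
    have "(LINT z|lebesgue. modulate (\<alpha> t) (r t) (p t) A z * g z)
      = (1 / r t) ^ ?D *\<^sub>R (LINT z|lebesgue. modulate (\<alpha> t) (r t) (p t) A ((1 / r t) *\<^sub>R z) * g ((1 / r t) *\<^sub>R z))"
      using nz(2)[OF that] by (intro integral_lebesgue_scaleR m) auto
    also have "(\<lambda>z. modulate (\<alpha> t) (r t) (p t) A ((1 / r t) *\<^sub>R z) * g ((1 / r t) *\<^sub>R z))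
      = (\<lambda>z. \<alpha> t * (A z * (chirp (p t / (r t)\<^sup>2) z * g ((1 / r t) *\<^sub>R z))))"
      using nz(2)[OF that] by (intro ext) (simp add: modulate_def chirp_scaleR power_divide mult_ac)
    finally show ?thesis
      by (simp only: H_def scaleR_conv_of_real integral_mult_right_zero) (simp only: mult_ac)
  qed
  have "continuous_on I (\<lambda>t. H (1 / r t) (p t / (r t)\<^sup>2))"
    unfolding continuous_on_sequentially o_def
  proof (intro allI ballI impI, elim conjE)
    fix x t assume t: "t \<in> I" "\<forall>n. x n \<in> I" "x \<longlonglongrightarrow> t"
    have rx: "(\<lambda>n. r (x n)) \<longlonglongrightarrow> r t" and px: "(\<lambda>n. p (x n)) \<longlonglongrightarrow> p t"
      using t c(2,3) unfolding continuous_on_sequentially o_def by blast+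
    show "(\<lambda>n. H (1 / r (x n)) (p (x n) / (r (x n))\<^sup>2)) \<longlonglongrightarrow> H (1 / r t) (p t / (r t)\<^sup>2)"
      unfolding H_def using nz(2) t
      by (intro tendsto_chirp_dilation_integral A g tendsto_intros rx px) force+
  qed
  then have "continuous_on I (\<lambda>t. \<alpha> t * of_real ((1 / r t) ^ ?D) * H (1 / r t) (p t / (r t)\<^sup>2))"
    using nz by (intro continuous_intros c) force+
  then show "continuous_on I (\<lambda>t. LINT z|lebesgue. modulate (\<alpha> t) (r t) (p t) A z * g z)"
    by (rule continuous_on_eq) (simp add: eq)
qed (simp add: Linf_modulate A nz)

text \<open>The difference at two times splits into changes of amplitude, dilation and chirp.
  Rescaling space by 1 / r t preserves the norm and turns the last two into comparisons with
  \<open>A\<close> itself, to which \<open>dilation_chirp_continuous\<close> applies.\<close>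

lemma norm_continuous_modulate:
  fixes A :: "real \<times> (real^'n) \<Rightarrow> complex"
  assumes A: "Linf A" and c: "continuous_on I \<alpha>" "continuous_on I r" "continuous_on I p"
    and nz: "\<And>t. t \<in> I \<Longrightarrow> \<alpha> t \<noteq> 0" "\<And>t. t \<in> I \<Longrightarrow> r t > 0"
    and dc: "dilation_chirp_continuous A"
  shows "norm_continuous_in_Linf I (\<lambda>t. modulate (\<alpha> t) (r t) (p t) A)"
  unfolding norm_continuous_in_Linf_def
proof (intro conjI ballI)
  fix t assume t: "t \<in> I"
  let ?F = "at t within I"
  let ?u = "\<lambda>t. modulate (\<alpha> t) (r t) (p t) A"
  have Am [measurable]: "A \<in> borel_measurable lebesgue" using A by (simp add: Linf_def)
  obtain N where N: "Linf_norm A = ereal N" using Linf_norm_cases[OF A] by metis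
  have lim: "(\<alpha> \<longlongrightarrow> \<alpha> t) ?F" "(r \<longlongrightarrow> r t) ?F" "(p \<longlongrightarrow> p t) ?F"
    using c t by (auto simp: continuous_on_def)
  have zero: "Linf_norm (\<lambda>z::real \<times> (real^'n). 0) = 0"
    by (simp add: Linf_norm_def esssup_const)
  define D where "D \<rho> = Linf_norm (\<lambda>z. A (\<rho> *\<^sub>R z) - A z)" for \<rho>
  define C where "C b = Linf_norm (\<lambda>z. chirp b z * A z - A z)" for b
  have D1: "D 1 = 0" and C0: "C 0 = 0" by (simp_all add: D_def C_def zero chirp_def)
  \<comment> \<open>Since \<open>D\<close> and \<open>C\<close> vanish at their base points, the
    punctured limits become limits along \<open>nhds\<close>. Hence \<open>\<rho>\<close> and
    \<open>b\<close> may take the values 1 and 0 for s near t.\<close>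
  have D: "(D \<longlongrightarrow> D 1) (nhds 1)" and C: "(C \<longlongrightarrow> C 0) (nhds 0)"
    unfolding tendsto_nhds_iff D1 C0
    using dc by (auto simp: D_def[abs_def] C_def[abs_def] dilation_chirp_continuous_def chirp_def)
  define \<rho> where "\<rho> s = r s / r t" for s
  define b where "b s = (p s - p t) / (r t)\<^sup>2" for s
  have Dl: "((\<lambda>s. D (\<rho> s)) \<longlongrightarrow> 0) ?F"
  proof -
    have "(\<rho> \<longlongrightarrow> r t / r t) ?F"
      unfolding \<rho>_def[abs_def] using nz(2)[OF t] by (intro tendsto_intros lim) auto
    then show ?thesis using filterlim_compose[OF D, of \<rho>] nz(2)[OF t] by (simp add: D1)
  qed
  have Cl: "((\<lambda>s. C (b s)) \<longlongrightarrow> 0) ?F"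
  proof -
    have "(b \<longlongrightarrow> (p t - p t) / (r t)\<^sup>2) ?F"
      unfolding b_def[abs_def] using nz(2)[OF t] by (intro tendsto_intros lim) auto
    then show ?thesis using filterlim_compose[OF C, of b] by (simp add: C0)
  qed
  have bound: "Linf_norm (\<lambda>z. ?u s z - ?u t z)
      \<le> ereal (norm (\<alpha> s - \<alpha> t) * N) + ereal (norm (\<alpha> t)) * (D (\<rho> s) + C (b s))" if s: "s \<in> I" for s
  proof -
    have rs: "r s > 0" "r t > 0" "\<alpha> t \<noteq> 0" using nz s t by auto
    let ?v = "\<lambda>z. chirp (p s) z * A (r s *\<^sub>R z) - chirp (p t) z * A (r t *\<^sub>R z)"
    have Asm: "(\<lambda>z. A (q *\<^sub>R z)) \<in> borel_measurable lebesgue" for q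
      by (rule borel_measurable_lebesgue_scaleR[OF Am])
    have vm: "?v \<in> borel_measurable lebesgue"
      using Asm by (intro borel_measurable_diff borel_measurable_times) auto
    have "Linf_norm (\<lambda>z. ?u s z - ?u t z) = Linf_norm (\<lambda>z. modulate (\<alpha> s - \<alpha> t) (r s) (p s) A z + \<alpha> t * ?v z)"
      by (rule arg_cong[where f = Linf_norm]) (simp add: modulate_def fun_eq_iff algebra_simps)
    also have "\<dots> \<le> Linf_norm (modulate (\<alpha> s - \<alpha> t) (r s) (p s) A) + Linf_norm (\<lambda>z. \<alpha> t * ?v z)"
      by (intro Linf_norm_triangle borel_measurable_modulate Am borel_measurable_times vm) auto
    also have "Linf_norm (modulate (\<alpha> s - \<alpha> t) (r s) (p s) A) = ereal (norm (\<alpha> s - \<alpha> t) * N)"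
    \<comment> \<open>\<open>Linf_norm_modulate\<close> asks for a nonzero amplitude, so a vanishing
      difference is treated apart.\<close>
    proof (cases "\<alpha> s = \<alpha> t")
      case True
      then have "modulate (\<alpha> s - \<alpha> t) (r s) (p s) A = (\<lambda>z. 0)" by (simp add: modulate_def fun_eq_iff)
      then show ?thesis using True zero by simp
    qed (use Linf_norm_modulate[OF Am _ rs(1)] N in simp)
    also have "Linf_norm (\<lambda>z. \<alpha> t * ?v z) = ereal (norm (\<alpha> t)) * Linf_norm ?v"
      using rs(3) by (intro Linf_norm_cmult) (auto simp: norm_mult)
    also have "Linf_norm ?v = Linf_norm (\<lambda>z. ?v ((1 / r t) *\<^sub>R z))"
      using rs by (intro Linf_norm_scaleR[OF vm, symmetric]) auto
    also have "(\<lambda>z. ?v ((1 / r t) *\<^sub>R z)) = (\<lambda>z. chirp (p s / (r t)\<^sup>2) z * (A (\<rho> s *\<^sub>R z) - A z)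
        + chirp (p t / (r t)\<^sup>2) z * (chirp (b s) z * A z - A z))"
    proof
      fix z :: "real \<times> (real^'n)"
      have "chirp (p s / (r t)\<^sup>2) z = chirp (p t / (r t)\<^sup>2) z * chirp (b s) z"
        by (simp add: chirp_add[symmetric] b_def diff_divide_distrib)
      then show "?v ((1 / r t) *\<^sub>R z) = chirp (p s / (r t)\<^sup>2) z * (A (\<rho> s *\<^sub>R z) - A z)
        + chirp (p t / (r t)\<^sup>2) z * (chirp (b s) z * A z - A z)"
        using rs by (simp add: chirp_scaleR power_divide \<rho>_def algebra_simps)
    qed
    also have "Linf_norm \<dots> \<le> Linf_norm (\<lambda>z. chirp (p s / (r t)\<^sup>2) z * (A (\<rho> s *\<^sub>R z) - A z))
        + Linf_norm (\<lambda>z. chirp (p t / (r t)\<^sup>2) z * (chirp (b s) z * A z - A z))"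
      using Asm by (intro Linf_norm_triangle borel_measurable_diff borel_measurable_times) auto
    also have "Linf_norm (\<lambda>z. chirp (p s / (r t)\<^sup>2) z * (A (\<rho> s *\<^sub>R z) - A z)) = D (\<rho> s)"
      unfolding D_def Linf_norm_def by (simp add: norm_mult)
    also have "Linf_norm (\<lambda>z. chirp (p t / (r t)\<^sup>2) z * (chirp (b s) z * A z - A z)) = C (b s)"
      unfolding C_def Linf_norm_def by (simp add: norm_mult)
    finally show ?thesis
      by (auto simp: add_left_mono ereal_mult_left_mono)
  qed
  show "((\<lambda>s. Linf_norm (\<lambda>z. ?u s z - ?u t z)) \<longlongrightarrow> 0) ?F"
  proof (rule tendsto_sandwich[where f = "\<lambda>_. 0"])
    show "((\<lambda>s. ereal (norm (\<alpha> s - \<alpha> t) * N) + ereal (norm (\<alpha> t)) * (D (\<rho> s) + C (b s))) \<longlongrightarrow> 0) ?F"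
    proof -
      have "((\<lambda>s. norm (\<alpha> s - \<alpha> t) * N) \<longlongrightarrow> norm (\<alpha> t - \<alpha> t) * N) ?F"
        by (intro tendsto_intros lim)
      then have 1: "((\<lambda>s. ereal (norm (\<alpha> s - \<alpha> t) * N)) \<longlongrightarrow> ereal 0) ?F"
        by (intro tendsto_ereal) simp
      have "((\<lambda>s. D (\<rho> s) + C (b s)) \<longlongrightarrow> 0 + 0) ?F"
        by (intro tendsto_add_ereal Dl Cl) auto
      then have "((\<lambda>s. ereal (norm (\<alpha> t)) * (D (\<rho> s) + C (b s))) \<longlongrightarrow> ereal (norm (\<alpha> t)) * (0 + 0)) ?F"
        by (intro tendsto_cmult_ereal) auto
      from tendsto_add_ereal[OF _ _ 1 this] show ?thesis by (simp add: zero_ereal_def[symmetric])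
    qed
    show "\<forall>\<^sub>F s in ?F. Linf_norm (\<lambda>z. ?u s z - ?u t z)
      \<le> ereal (norm (\<alpha> s - \<alpha> t) * N) + ereal (norm (\<alpha> t)) * (D (\<rho> s) + C (b s))"
      using bound by (auto simp: eventually_at_filter)
  qed (auto simp: Linf_norm_nonneg)
qed (simp add: Linf_modulate A nz)

section \<open>Test functions\<close>

text \<open>Off the closed support the function vanishes on a whole neighbourhood.\<close>

lemma partial_outside_support:
  assumes "z \<notin> closure {z. f z \<noteq> 0}"
  shows "partial b f z = 0"
proof -
  let ?U = "- closure {z. f z \<noteq> 0}"
  have zero: "0 = f w" if "w \<in> ?U" for w
    using that closure_subset[of "{z. f z \<noteq> 0}"] by force
  have "(f has_derivative (\<lambda>_. 0)) (at z)"
  proof (rule has_derivative_transform_within_open[where s = ?U, OF has_derivative_const])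
    show "z \<in> ?U" by (rule ComplI) (use assms in simp)
  qed (intro open_Compl closed_closure, rule zero)
  then show ?thesis by (rule partial_eqI)
qed

lemma closure_support_partial:
  "closure {z. partial b f z \<noteq> 0} \<subseteq> closure {z. f z \<noteq> 0}"
proof (rule closure_minimal)
  show "{z. partial b f z \<noteq> 0} \<subseteq> closure {z. f z \<noteq> 0}"
    using partial_outside_support by blast
qed simp

lemma test_function_partial:
  assumes "test_function U f" "b \<in> Basis"
  shows "test_function U (partial b f)"
  unfolding test_function_def
proof (intro conjI allI)
  show "Ck m (partial b f)" for m
    using assms by (intro Ck_partial) (auto simp: test_function_def simp del: Ck.simps)
  show "compact (closure {z. partial b f z \<noteq> 0})"
    using assms(1) closure_support_partial[of b f] compact_Int_closed[of "closure {z. f z \<noteq> 0}" "closure {z. partial b f z \<noteq> 0}"]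
    by (simp add: test_function_def inf_absorb2)
  show "closure {z. partial b f z \<noteq> 0} \<subseteq> U"
    using assms(1) closure_support_partial[of b f] by (auto simp: test_function_def)
qed

lemma test_function_integrable:
  fixes f :: "'a::euclidean_space \<Rightarrow> complex"
  assumes "test_function U f" "continuous_on UNIV h"
  shows "integrable lebesgue (\<lambda>z. h z * f z)"
proof -
  have "bounded (closure {z. f z \<noteq> 0})" using assms(1) by (auto simp: test_function_def compact_imp_bounded)
  then obtain R where R: "\<And>z. z \<in> closure {z. f z \<noteq> 0} \<Longrightarrow> norm z \<le> R"
    by (auto simp: bounded_iff)
  have "f z = 0" if "z \<notin> cball 0 R" for z
    using R[of z] that closure_subset[of "{z. f z \<noteq> 0}"] by force
  moreover have "continuous_on UNIV f" using assms(1) Ck_imp_continuous_on by (auto simp: test_function_def)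
  ultimately show ?thesis
    by (intro integrable_lebesgue_compact_support[of _ R] continuous_intros assms(2)) auto
qed

lemma test_function_box_op_integrable:
  assumes "test_function U f"
  shows "integrable lebesgue (box_op f)"
proof -
  have "integrable lebesgue (partial b (partial b f))" if "b \<in> Basis" for b
    using test_function_integrable[OF test_function_partial[OF test_function_partial[OF assms that] that], of "\<lambda>_. 1"]
    by simp
  then show ?thesis
    unfolding box_op_def[abs_def] by (auto simp: Basis_pair)
qed

text \<open>The projection of the support to the time axis is compact in the open interval
  \<open>J\<close>, so there is room on both sides. The strict inequalities will make the boundary
  terms at \<alpha> and \<beta> vanish.\<close>

lemma test_function_slab:
  fixes \<phi> :: "real \<times> 'a::euclidean_space \<Rightarrow> complex"
  assumes J: "open J" "is_interval J" "J \<noteq> {}" and \<phi>: "test_function (J \<times> UNIV) \<phi>"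
  obtains \<alpha> \<beta> R where "\<alpha> \<le> \<beta>" "{\<alpha>..\<beta>} \<subseteq> J"
    "\<And>t z. (t, z) \<in> closure {x. \<phi> x \<noteq> 0} \<Longrightarrow> \<alpha> < t \<and> t < \<beta> \<and> norm z \<le> R"
proof (cases "closure {x. \<phi> x \<noteq> 0} = {}")
  case True
  \<comment> \<open>With empty support any one-point slab will do.\<close>
  obtain t0 where "t0 \<in> J" using J by auto
  then show ?thesis by (intro that[of t0 t0 0]) (simp_all only: True atLeastAtMost_singleton empty_iff order_refl, simp)
next
  case False
  define S where "S = closure {x. \<phi> x \<noteq> 0}"
  have S: "compact S" "S \<subseteq> J \<times> UNIV" using \<phi> unfolding test_function_def S_def by blast+
  have K: "compact (fst ` S)" "fst ` S \<noteq> {}"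
    using compact_continuous_image[OF continuous_on_fst[OF continuous_on_id] S(1)] False unfolding S_def by blast+
  obtain t1 where t1: "t1 \<in> fst ` S" "\<And>t. t \<in> fst ` S \<Longrightarrow> t1 \<le> t"
    using compact_attains_inf[OF K] by blast
  obtain t2 where t2: "t2 \<in> fst ` S" "\<And>t. t \<in> fst ` S \<Longrightarrow> t \<le> t2"
    using compact_attains_sup[OF K] by blast
  have tJ: "t1 \<in> J" "t2 \<in> J" using t1(1) t2(1) image_mono[OF S(2), of fst] by auto
  obtain e1 where e1: "e1 > 0" "cball t1 e1 \<subseteq> J" using J(1) tJ(1) open_contains_cball by blast
  obtain e2 where e2: "e2 > 0" "cball t2 e2 \<subseteq> J" using J(1) tJ(2) open_contains_cball by blast
  have ends: "t1 - e1 \<in> J" "t2 + e2 \<in> J" using e1 e2 by (auto simp: subset_iff dist_real_def)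
  have le: "t1 \<le> t2" by (rule t1(2)[OF t2(1)])
  obtain R where R: "\<And>x. x \<in> S \<Longrightarrow> norm x \<le> R"
    using compact_imp_bounded[OF S(1)] unfolding bounded_iff by blast
  show ?thesis
  proof (rule that[of "t1 - e1" "t2 + e2" R])
    show "t1 - e1 \<le> t2 + e2" using le e1 e2 by simp
    show "{t1 - e1..t2 + e2} \<subseteq> J"
      using segment_subset_interval[OF J(2) ends] le e1 e2 by (simp add: min_absorb1 max_absorb2)
    show "t1 - e1 < t \<and> t < t2 + e2 \<and> norm z \<le> R" if tz: "(t, z) \<in> closure {x. \<phi> x \<noteq> 0}" for t z
    proof -
      have that: "(t, z) \<in> S" using tz by (simp only: S_def)
      have "t \<in> fst ` S" using imageI[OF that, of fst] by simp
      then have "t1 \<le> t" "t \<le> t2" by (rule t1(2), rule t2(2))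
      moreover have "norm z \<le> R" using R[OF that] norm_snd_le[of z t] by linarith
      ultimately show ?thesis using e1 e2 by auto
    qed
  qed
qed

section \<open>Integrating a total time derivative\<close>

text \<open>Fubini is applied on a product of Borel measures, while \<open>A\<close> is measurable
  only for the completion. The bound at every point serves to dominate the integrand on the
  product.\<close>

lemma borel_representative:
  fixes A :: "'a::euclidean_space \<Rightarrow> complex"
  assumes "Linf A"
  obtains A' N where "A' \<in> borel_measurable borel" "\<And>z. norm (A' z) \<le> N" "AE z in lebesgue. A z = A' z"
proof -
  obtain N where N: "0 \<le> N" "AE z in lebesgue. norm (A z) \<le> N"
    using Linf_norm_cases[OF assms] by metis
  have Am: "A \<in> borel_measurable lebesgue" using assms by (simp add: Linf_def)
  have "(\<lambda>z. Re (A z)) \<in> borel_measurable lebesgue" "(\<lambda>z. Im (A z)) \<in> borel_measurable lebesgue"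
    using Am by auto
  from this[THEN completion_ex_borel_measurable_real] obtain u v where
    [measurable]: "u \<in> borel_measurable lborel" "v \<in> borel_measurable lborel" and
    uv: "AE z in lborel. Re (A z) = u z" "AE z in lborel. Im (A z) = v z" by blast
  have [measurable]: "u \<in> borel_measurable borel" "v \<in> borel_measurable borel" by simp_all
  define B where "B z = complex_of_real (u z) + \<i> * complex_of_real (v z)" for z
  have [measurable]: "B \<in> borel_measurable borel" unfolding B_def[abs_def] by measurable
  \<comment> \<open>The value 0 replaces \<open>B\<close> where the bound fails, which happens only
    on a null set.\<close>
  define A' where "A' z = (if norm (B z) \<le> N then B z else 0)" for z
  show ?thesis
  proof (rule that[of A' N])
    show "A' \<in> borel_measurable borel" unfolding A'_def[abs_def] by measurable
    show "norm (A' z) \<le> N" for z using N by (simp add: A'_def)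
    show "AE z in lebesgue. A z = A' z"
      using N(2) AE_completion[OF uv(1)] AE_completion[OF uv(2)]
    proof eventually_elim
      case (elim z)
      then have "B z = A z" by (simp add: B_def complex_eq_iff)
      then show ?case using elim by (simp add: A'_def)
    qed
  qed
qed

text \<open>After the exchange of integrals \<open>A w\<close> is a constant factor of the time
  integral, and the fundamental theorem leaves only the values of \<open>g\<close> at the two
  ends.\<close>

lemma integral_time_derivative_eq_0:
  fixes A :: "'a::euclidean_space \<Rightarrow> complex" and G g :: "real \<Rightarrow> 'a \<Rightarrow> complex"
  assumes A: "Linf A" and ab: "\<alpha> \<le> \<beta>"
    and G: "continuous_on ({\<alpha>..\<beta>} \<times> UNIV) (\<lambda>x. G (fst x) (snd x))"
    and supp: "\<And>t w. t \<in> {\<alpha>..\<beta>} \<Longrightarrow> w \<notin> cball 0 R \<Longrightarrow> G t w = 0"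
    and deriv: "\<And>t w. t \<in> {\<alpha>..\<beta>} \<Longrightarrow> ((\<lambda>t. g t w) has_vector_derivative G t w) (at t)"
    and ends: "\<And>w. g \<alpha> w = 0" "\<And>w. g \<beta> w = 0"
  shows "(LINT t|lebesgue. indicat_real {\<alpha>..\<beta>} t *\<^sub>R (LINT w|lebesgue. A w * G t w)) = 0"
proof -
  obtain A' N where [measurable]: "A' \<in> borel_measurable borel"
    and A': "\<And>z. norm (A' z) \<le> N" "AE z in lebesgue. A z = A' z"
    using borel_representative[OF A] by blast
  have N: "0 \<le> N" using A'(1)[of undefined] norm_ge_zero order_trans by blast
  let ?S = "{\<alpha>..\<beta>} \<times> cball (0 :: 'a) R"
  define F where "F t w = indicat_real {\<alpha>..\<beta>} t *\<^sub>R (A' w * G t w)" for t w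
  \<comment> \<open>\<open>G\<close> is continuous on a set that is compact in time and space
    together; this gives integrability on the product.\<close>
  have "integrable lborel (\<lambda>x. indicat_real ?S x *\<^sub>R G (fst x) (snd x))"
    by (rule borel_integrable_compact) (auto intro: compact_Times continuous_on_subset[OF G])
  then have int0: "integrable (lborel \<Otimes>\<^sub>M lborel) (\<lambda>x. indicat_real ?S x *\<^sub>R G (fst x) (snd x))"
    by (simp add: lborel_prod)
  have Feq: "(\<lambda>(t, w). F t w) = (\<lambda>x. A' (snd x) * (indicat_real ?S x *\<^sub>R G (fst x) (snd x)))"
    using supp by (auto simp: F_def indicator_def fun_eq_iff)
  have intF: "integrable (lborel \<Otimes>\<^sub>M lborel) (\<lambda>(t, w). F t w)"
    unfolding Feq
  proof (rule Bochner_Integration.integrable_bound)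
    show "integrable (lborel \<Otimes>\<^sub>M lborel) (\<lambda>x. N *\<^sub>R (indicat_real ?S x *\<^sub>R G (fst x) (snd x)))"
      using int0 by (rule integrable_scaleR_right)
    have "(\<lambda>x. A' (snd x)) \<in> borel_measurable ((lborel :: real measure) \<Otimes>\<^sub>M lborel)" by measurable
    then show "(\<lambda>x. A' (snd x) * (indicat_real ?S x *\<^sub>R G (fst x) (snd x))) \<in> borel_measurable (lborel \<Otimes>\<^sub>M lborel)"
      using borel_measurable_integrable[OF int0] by (rule borel_measurable_times)
    show "AE x in lborel \<Otimes>\<^sub>M lborel. norm (A' (snd x) * (indicat_real ?S x *\<^sub>R G (fst x) (snd x)))
        \<le> norm (N *\<^sub>R (indicat_real ?S x *\<^sub>R G (fst x) (snd x)))"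
      unfolding norm_mult norm_scaleR abs_of_nonneg[OF N]
      by (intro AE_I2 mult_right_mono A'(1)) auto
  qed
  have inner: "indicat_real {\<alpha>..\<beta>} t *\<^sub>R (LINT w|lebesgue. A w * G t w) = (LINT w|lborel. F t w)" for t
  proof (cases "t \<in> {\<alpha>..\<beta>}")
    case True
    have "continuous_on UNIV (\<lambda>w. G (fst (t, w)) (snd (t, w)))"
      by (rule continuous_on_compose2[OF G]) (use True in \<open>auto intro!: continuous_intros\<close>)
    then have Gt: "G t \<in> borel_measurable borel"
      by (intro borel_measurable_continuous_onI) simp
    then have AG: "(\<lambda>w. A' w * G t w) \<in> borel_measurable lborel" by simp
    have Gt': "G t \<in> borel_measurable lebesgue"
      using Gt by (intro measurable_completion) simp
    have "(LINT w|lebesgue. A w * G t w) = (LINT w|lebesgue. A' w * G t w)"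
    proof (rule integral_cong_AE)
      show "(\<lambda>w. A w * G t w) \<in> borel_measurable lebesgue"
        using A Gt' by (intro borel_measurable_times) (auto simp: Linf_def)
      show "(\<lambda>w. A' w * G t w) \<in> borel_measurable lebesgue"
        by (rule measurable_completion[OF AG])
      show "AE w in lebesgue. A w * G t w = A' w * G t w"
        using A'(2) by eventually_elim simp
    qed
    also have "\<dots> = (LINT w|lborel. A' w * G t w)"
      by (rule integral_completion[OF AG])
    finally show ?thesis using True by (simp add: F_def)
  qed (simp add: F_def)
  have "(LINT t|lebesgue. indicat_real {\<alpha>..\<beta>} t *\<^sub>R (LINT w|lebesgue. A w * G t w))
      = (LINT t|lborel. LINT w|lborel. F t w)"
    unfolding inner by (rule integral_completion) (rule borel_measurable_integrable[OF lborel_pair.integrable_fst[OF intF]])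
  also have "\<dots> = (LINT w|lborel. LINT t|lborel. F t w)"
    by (rule lborel_pair.Fubini_integral[OF intF, symmetric])
  also have "\<dots> = (LINT w|(lborel :: 'a measure). 0)"
  proof (rule Bochner_Integration.integral_cong[OF refl])
    fix w
    have "(LINT t|lborel. indicat_real {\<alpha>..\<beta>} t *\<^sub>R G t w) = g \<beta> w - g \<alpha> w"
    proof (rule integral_FTC_atLeastAtMost[OF ab])
      have "continuous_on {\<alpha>..\<beta>} (\<lambda>t. G (fst (t, w)) (snd (t, w)))"
        by (rule continuous_on_compose2[OF G]) (auto intro!: continuous_intros)
      then show "continuous_on {\<alpha>..\<beta>} (\<lambda>t. G t w)" by simp
      show "((\<lambda>t. g t w) has_vector_derivative G t w) (at t within {\<alpha>..\<beta>})" if "\<alpha> \<le> t" "t \<le> \<beta>" for t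
        using deriv[of t w] that by (auto intro: has_vector_derivative_at_within)
    qed
    moreover have "(LINT t|lborel. F t w) = A' w * (LINT t|lborel. indicat_real {\<alpha>..\<beta>} t *\<^sub>R G t w)"
      unfolding F_def by (subst integral_mult_right_zero[symmetric]) (simp add: mult_scaleR_right)
    ultimately show "(LINT t|lborel. F t w) = 0" by (simp add: ends)
  qed
  finally show ?thesis by simp
qed

section \<open>Pulling test functions back along the flow\<close>

text \<open>The Jacobian m^d of z = m w times the amplitude m^(- d / 2) of \<open>psi\<close> is
  m^(d / 2), that is q powr (d / 4).\<close>

definition envelope :: "nat \<Rightarrow> real \<Rightarrow> real \<Rightarrow> real \<Rightarrow> real \<Rightarrow> complex" where
  "envelope d \<gamma> k a0 t =
     of_real (dilation_sq k a0 t powr (real d / 4)) * exp (\<i> * of_real (\<gamma> * clock k a0 t))"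

text \<open>The derivative of \<open>\<phi>\<close> at \<open>x\<close> in the spatial direction
  \<open>w\<close>. Point and direction are separate because \<open>\<phi>\<close> is evaluated at m
  w, while the chain rule in time differentiates along w.\<close>

definition radial_derivative ::
    "(real \<times> (real \<times> (real^'n)) \<Rightarrow> complex) \<Rightarrow> real \<times> (real \<times> (real^'n)) \<Rightarrow> real \<times> (real^'n) \<Rightarrow> complex" where
  "radial_derivative \<phi> x w = of_real (fst w) * partial (0, (1, 0)) \<phi> x
     + (\<Sum>j\<in>UNIV. of_real (snd w $ j) * partial (0, (0, axis j 1)) \<phi> x)"

definition pullback ::
    "nat \<Rightarrow> real \<Rightarrow> real \<Rightarrow> real \<Rightarrow> (real \<times> (real \<times> (real^'n)) \<Rightarrow> complex) \<Rightarrow>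
     real \<Rightarrow> real \<times> (real^'n) \<Rightarrow> complex" where
  "pullback d \<gamma> k a0 \<phi> t w = envelope d \<gamma> k a0 t *
     (chirp (rate_num k a0 t / 4) w * \<phi> (t, sqrt (dilation_sq k a0 t) *\<^sub>R w))"

text \<open>Written out so that joint continuity and vanishing off the support can be read off. The
  three summands in front of \<open>\<phi>\<close> come from q powr (d / 4), from
  \<open>clock\<close> and from the chirp rate; p / sqrt q is m'.\<close>

definition pullback_deriv ::
    "nat \<Rightarrow> real \<Rightarrow> real \<Rightarrow> real \<Rightarrow> (real \<times> (real \<times> (real^'n)) \<Rightarrow> complex) \<Rightarrow>
     real \<Rightarrow> real \<times> (real^'n) \<Rightarrow> complex" where
  "pullback_deriv d \<gamma> k a0 \<phi> t w =
     (let q = dilation_sq k a0 t; p = rate_num k a0 t; x = (t, sqrt q *\<^sub>R w) in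
      envelope d \<gamma> k a0 t * (chirp (p / 4) w *
        ((of_real (real d * p / (2 * q)) + \<i> * of_real (\<gamma> / q) + \<i> * of_real ((a0\<^sup>2 + 4 * k) / 4 * hyp w)) * \<phi> x
          + partial (1, 0) \<phi> x + of_real (p / sqrt q) * radial_derivative \<phi> x w)))"

lemma frechet_derivative_eq_radial:
  fixes \<phi> :: "real \<times> (real \<times> (real^'n)) \<Rightarrow> complex"
  assumes "\<phi> differentiable (at x)"
  shows "frechet_derivative \<phi> (at x) (s, r *\<^sub>R w) = of_real s * partial (1, 0) \<phi> x + of_real r * radial_derivative \<phi> x w"
proof -
  interpret linear "frechet_derivative \<phi> (at x)"
    using assms by (rule linear_frechet_derivative)
  have "(\<Sum>j\<in>UNIV. (snd w $ j) *\<^sub>R axis j 1) = snd w"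
    using basis_expansion[of "snd w"] by (simp add: scalar_mult_eq_scaleR)
  then have e: "(s, r *\<^sub>R w) = s *\<^sub>R (1, 0) + r *\<^sub>R (fst w *\<^sub>R (0, (1, 0)) + (\<Sum>j\<in>UNIV. snd w $ j *\<^sub>R (0, (0, axis j 1))))"
    by (simp add: prod_eq_iff fst_sum snd_sum)
  show ?thesis
    unfolding e add scale sum radial_derivative_def partial_def by (simp add: scaleR_conv_of_real)
qed

lemma pullback_has_vector_derivative:
  fixes \<phi> :: "real \<times> (real \<times> (real^'n)) \<Rightarrow> complex"
  assumes t: "t \<in> lifespan k a0" and \<phi>: "\<And>x. \<phi> differentiable (at x)"
  shows "((\<lambda>t. pullback d \<gamma> k a0 \<phi> t w) has_vector_derivative pullback_deriv d \<gamma> k a0 \<phi> t w) (at t)"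
proof -
  let ?q = "dilation_sq k a0" and ?p = "rate_num k a0"
  have q: "?q t > 0" by (rule dilation_sq_pos[OF t])
  define x where "x = (t, sqrt (?q t) *\<^sub>R w)"
  have 1: "((\<lambda>t. ?q t powr (real d / 4)) has_real_derivative
      ?q t powr (real d / 4) * (real d * ?p t / (2 * ?q t))) (at t)"
  proof -
    have "((\<lambda>t. ?q t powr (real d / 4)) has_real_derivative
        (real d / 4) * ?q t powr (real d / 4 - 1) * (2 * ?p t)) (at t)"
      by (rule DERIV_chain2[OF has_real_derivative_powr[OF q] DERIV_dilation_sq])
    also have "(real d / 4) * ?q t powr (real d / 4 - 1) * (2 * ?p t)
        = ?q t powr (real d / 4) * (real d * ?p t / (2 * ?q t))"
    proof -
      have "?q t powr (real d / 4 - 1) = ?q t powr (real d / 4) / ?q t"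
        using q by (simp add: powr_diff)
      then show ?thesis by simp
    qed
    finally show ?thesis .
  qed
  have 1: "((\<lambda>t. complex_of_real (?q t powr (real d / 4))) has_vector_derivative
      of_real (?q t powr (real d / 4) * (real d * ?p t / (2 * ?q t)))) (at t)"
    using 1 by (rule has_vector_derivative_of_real)
  have e: "((\<lambda>t. exp (\<i> * complex_of_real (f t))) has_vector_derivative
      \<i> * of_real f' * exp (\<i> * of_real (f t))) (at t)" if "(f has_real_derivative f') (at t)" for f f'
  proof -
    have "((\<lambda>t. \<i> * complex_of_real (f t)) has_vector_derivative \<i> * of_real f') (at t)"
      by (rule has_vector_derivative_mult_right[OF has_vector_derivative_of_real[OF that]])
    from field_vector_diff_chain_at[OF this DERIV_exp] show ?thesis by (simp add: o_def)
  qed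
  have 2: "((\<lambda>t. exp (\<i> * complex_of_real (\<gamma> * clock k a0 t))) has_vector_derivative
      \<i> * of_real (\<gamma> / ?q t) * exp (\<i> * of_real (\<gamma> * clock k a0 t))) (at t)"
    using e[OF DERIV_cmult[OF DERIV_clock[OF t], of \<gamma>]] by simp
  have 3: "((\<lambda>t. chirp (?p t / 4) w) has_vector_derivative
      \<i> * of_real ((a0\<^sup>2 + 4 * k) / 4 * hyp w) * chirp (?p t / 4) w) (at t)"
    unfolding chirp_def
    by (rule e) (auto intro!: derivative_eq_intros DERIV_rate_num)
  have 4: "((\<lambda>t. \<phi> (t, sqrt (?q t) *\<^sub>R w)) has_vector_derivative
      (partial (1, 0) \<phi> x + of_real (?p t / sqrt (?q t)) * radial_derivative \<phi> x w)) (at t)"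
  proof -
    have s: "((\<lambda>t. sqrt (?q t)) has_real_derivative ?p t / sqrt (?q t)) (at t)"
      using q by (auto intro!: derivative_eq_intros DERIV_dilation_sq simp: field_simps)
    have "((\<lambda>t. (t, sqrt (?q t) *\<^sub>R w)) has_vector_derivative (1, (?p t / sqrt (?q t)) *\<^sub>R w)) (at t)"
      using has_vector_derivative_Pair[OF has_vector_derivative_id
          has_vector_derivative_scaleR[OF s has_vector_derivative_const[of w]]] by simp
    moreover have "(\<phi> has_derivative frechet_derivative \<phi> (at x)) (at (t, sqrt (?q t) *\<^sub>R w))"
      using \<phi>[of x] unfolding frechet_derivative_works x_def .
    ultimately have "(\<phi> \<circ> (\<lambda>t. (t, sqrt (?q t) *\<^sub>R w)) has_vector_derivative
        frechet_derivative \<phi> (at x) (1, (?p t / sqrt (?q t)) *\<^sub>R w)) (at t)"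
      by (rule vector_derivative_diff_chain_within[OF _ has_derivative_at_withinI])
    then show ?thesis
      by (simp add: o_def frechet_derivative_eq_radial[OF \<phi>])
  qed
  note D = has_vector_derivative_mult[OF has_vector_derivative_mult[OF 1 2] has_vector_derivative_mult[OF 3 4]]
  show ?thesis
    unfolding pullback_def[abs_def] pullback_deriv_def envelope_def Let_def
    by (rule has_vector_derivative_eq_rhs[OF D]) (simp add: x_def algebra_simps)
qed

lemma continuous_on_clock: "continuous_on (lifespan k a0) (clock k a0)"
  by (intro continuous_at_imp_continuous_on ballI DERIV_isCont[OF DERIV_clock])

lemma continuous_on_pullback_deriv:
  fixes \<phi> :: "real \<times> (real \<times> (real^'n)) \<Rightarrow> complex"
  assumes I: "I \<subseteq> lifespan k a0" and \<phi>: "Ck (Suc 0) \<phi>"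
  shows "continuous_on (I \<times> UNIV) (\<lambda>x. pullback_deriv d \<gamma> k a0 \<phi> (fst x) (snd x))"
proof -
  let ?q = "dilation_sq k a0" and ?p = "rate_num k a0"
  have q: "?q (fst x) > 0" if "x \<in> I \<times> UNIV" for x :: "real \<times> (real \<times> (real^'n))"
    using that I dilation_sq_pos by auto
  have cq: "continuous_on S (\<lambda>x. ?q (fst x))" and cp: "continuous_on S (\<lambda>x. ?p (fst x))"
    for S :: "(real \<times> (real \<times> (real^'n))) set"
    by (auto intro!: continuous_on_compose2[OF continuous_on_dilation_sq[of UNIV]]
        continuous_on_compose2[OF continuous_on_rate_num[of UNIV]] continuous_intros)
  have ch: "continuous_on S (\<lambda>x. hyp (snd x))" for S :: "(real \<times> (real \<times> (real^'n))) set"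
    by (auto intro!: continuous_on_compose2[OF continuous_on_hyp[of UNIV]] continuous_intros)
  have cc: "continuous_on (I \<times> UNIV) (\<lambda>x :: real \<times> (real \<times> (real^'n)). clock k a0 (fst x))"
    using I by (auto intro!: continuous_on_compose2[OF continuous_on_clock] continuous_intros)
  have cf: "continuous_on (I \<times> UNIV) (\<lambda>x. f (fst x, sqrt (?q (fst x)) *\<^sub>R snd x))"
    if "continuous_on UNIV f" for f :: "real \<times> (real \<times> (real^'n)) \<Rightarrow> complex"
    by (rule continuous_on_compose2[OF that]) (auto intro!: continuous_intros cq)
  have B: "(1, 0) \<in> (Basis :: (real \<times> (real \<times> (real^'n))) set)"
    "(0, (1, 0)) \<in> (Basis :: (real \<times> (real \<times> (real^'n))) set)"
    "(0, (0, axis j 1)) \<in> (Basis :: (real \<times> (real \<times> (real^'n))) set)" for j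
    by (auto simp: Basis_prod_def)
  note cpart = cf[OF Ck_imp_continuous_on[OF Ck_partial[OF \<phi>]]]
  show ?thesis
    unfolding pullback_deriv_def Let_def envelope_def chirp_def radial_derivative_def
    by (intro continuous_intros cq cp ch cc cf[OF Ck_imp_continuous_on[OF \<phi>]] cpart B)
      (use q in force)+
qed

text \<open>Read m = sqrt q, p = m m', c for the energy, h for \<open>hyp w\<close>, W for the
  radial derivative and B for \<open>box_op\<close>. The terms with d cancel, as do those with W and
  with \<gamma>; the multiples of h add up to (c m^2 - p^2 - 4 k) / (4 m^2) = 0.\<close>

lemma chirp_transport_identity:
  fixes m p c k \<gamma> h f ft W B d :: complex
  assumes "m \<noteq> 0" and k: "4 * k = c * m\<^sup>2 - p\<^sup>2"
  shows "- \<i> * ft + B =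
    - \<i> * ((d * p / (2 * m\<^sup>2) + \<i> * (\<gamma> / m\<^sup>2) + \<i> * (c / 4 * h)) * f + ft + p / m * W)
    + 1 / m\<^sup>2 * (\<i> * (2 * (p / 4) * d) * f - 4 * (p / 4)\<^sup>2 * h * f + \<i> * (4 * (p / 4)) * (m * W) + m\<^sup>2 * B
       - (k * h + \<gamma>) * f)"
proof -
  have k': "k = (c * m\<^sup>2 - p\<^sup>2) / 4" unfolding k[symmetric] by simp
  show ?thesis unfolding k' using assms(1)
    by (simp add: field_simps power2_eq_square)
qed

text \<open>The linear part of the equation after dilation, chirp and phase. The \<open>d\<close>
  from the amplitude must cancel the \<open>d\<close> from the wave operator of the chirp, so it has
  to be the space dimension.\<close>

lemma pullback_box_op:
  fixes \<phi> :: "real \<times> (real \<times> (real^'n)) \<Rightarrow> complex"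
  assumes t: "t \<in> lifespan k a0" and \<phi>: "\<And>m. Ck m \<phi>" and d: "d = CARD('n) + 1"
  defines "q \<equiv> dilation_sq k a0 t"
  shows "envelope d \<gamma> k a0 t * chirp (rate_num k a0 t / 4) w *
      (- \<i> * partial (1, 0) \<phi> (t, sqrt q *\<^sub>R w) + box_op (\<lambda>w. \<phi> (t, w)) (sqrt q *\<^sub>R w))
    = - \<i> * pullback_deriv d \<gamma> k a0 \<phi> t w
      + of_real (1 / q) * (box_op (pullback d \<gamma> k a0 \<phi> t) w
          - of_real (k * hyp w + \<gamma>) * pullback d \<gamma> k a0 \<phi> t w)"
proof -
  let ?p = "rate_num k a0 t" and ?K = "envelope d \<gamma> k a0 t" and ?m = "sqrt q"
  let ?x = "(t, ?m *\<^sub>R w)"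
  let ?f = "\<lambda>w. \<phi> (t, ?m *\<^sub>R w)"
  have q: "q > 0" using dilation_sq_pos[OF t] by (simp add: q_def)
  have mm: "of_real ?m * of_real ?m = complex_of_real q" "(complex_of_real ?m)\<^sup>2 = of_real q"
    using q by (simp_all flip: of_real_mult of_real_power)
  have C: "Ck (Suc (Suc 0)) ?f" "Ck (Suc (Suc 0)) (\<lambda>w. chirp (?p / 4) w * ?f w)"
    by (intro Ck_mult Ck_chirp Ck_scale_slice \<phi>)+
  have part: "partial b ?f w = of_real ?m * partial (0, b) \<phi> ?x" for b
    by (rule partial_scale_slice) (rule Ck_differentiable[OF \<phi>])
  have rad: "of_real (fst w) * partial (1, 0) ?f w + (\<Sum>j\<in>UNIV. of_real (snd w $ j) * partial (0, axis j 1) ?f w)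
      = of_real ?m * radial_derivative \<phi> ?x w"
    unfolding part radial_derivative_def by (simp add: algebra_simps sum_distrib_left)
  have "box_op (pullback d \<gamma> k a0 \<phi> t) w = ?K * box_op (\<lambda>w. chirp (?p / 4) w * ?f w) w"
    unfolding pullback_def q_def[symmetric] by (rule box_op_cmult[OF C(2)])
  also have "\<dots> = ?K * (chirp (?p / 4) w *
      (\<i> * of_real (2 * (?p / 4) * real d) * \<phi> ?x - of_real (4 * (?p / 4)\<^sup>2 * hyp w) * \<phi> ?x
       + \<i> * of_real (4 * (?p / 4)) * (of_real ?m * radial_derivative \<phi> ?x w)
       + of_real q * box_op (\<lambda>w. \<phi> (t, w)) (?m *\<^sub>R w)))"
    unfolding box_op_chirp_mult[OF C(1)] rad box_op_scale_slice[OF \<phi>] using d q by simp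
  finally have box: "box_op (pullback d \<gamma> k a0 \<phi> t) w = \<dots>" .
  have en: "4 * complex_of_real k = of_real (a0\<^sup>2 + 4 * k) * (of_real ?m)\<^sup>2 - (of_real ?p)\<^sup>2"
    unfolding mm(2) using arg_cong[OF dilation_sq_energy[of a0 k t], of complex_of_real] by (simp add: q_def)
  have "complex_of_real ?m \<noteq> 0" using q by simp
  from chirp_transport_identity[OF this en, of "partial (1, 0) \<phi> ?x" "box_op (\<lambda>w. \<phi> (t, w)) (?m *\<^sub>R w)" "of_real d"
      "of_real \<gamma>" "of_real (hyp w)" "\<phi> ?x" "radial_derivative \<phi> ?x w"]
  have "- \<i> * partial (1, 0) \<phi> ?x + box_op (\<lambda>w. \<phi> (t, w)) (?m *\<^sub>R w) =
    - \<i> * ((of_real (real d * ?p / (2 * q)) + \<i> * of_real (\<gamma> / q) + \<i> * of_real ((a0\<^sup>2 + 4 * k) / 4 * hyp w)) * \<phi> ?x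
        + partial (1, 0) \<phi> ?x + of_real (?p / ?m) * radial_derivative \<phi> ?x w)
    + of_real (1 / q) * (\<i> * of_real (2 * (?p / 4) * real d) * \<phi> ?x - of_real (4 * (?p / 4)\<^sup>2 * hyp w) * \<phi> ?x
       + \<i> * of_real (4 * (?p / 4)) * (of_real ?m * radial_derivative \<phi> ?x w)
       + of_real q * box_op (\<lambda>w. \<phi> (t, w)) (?m *\<^sub>R w) - of_real (k * hyp w + \<gamma>) * \<phi> ?x)"
    unfolding mm(2) by simp
  then show ?thesis
    unfolding box pullback_deriv_def pullback_def Let_def q_def[symmetric]
    by (simp only:) (simp only: algebra_simps)
qed

lemma test_function_pullback:
  fixes \<phi> :: "real \<times> (real \<times> (real^'n)) \<Rightarrow> complex"
  assumes t: "t \<in> lifespan k a0" and \<phi>: "test_function U \<phi>"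
  shows "test_function UNIV (pullback d \<gamma> k a0 \<phi> t)"
proof -
  let ?m = "sqrt (dilation_sq k a0 t)"
  have m: "?m > 0" using dilation_sq_pos[OF t] by simp
  have "bounded (closure {x. \<phi> x \<noteq> 0})" using \<phi> by (auto simp: test_function_def compact_imp_bounded)
  then obtain R where R: "\<And>x. x \<in> closure {x. \<phi> x \<noteq> 0} \<Longrightarrow> norm x \<le> R"
    unfolding bounded_iff by blast
  have "{w. pullback d \<gamma> k a0 \<phi> t w \<noteq> 0} \<subseteq> cball 0 (R / ?m)"
  proof
    fix w assume "w \<in> {w. pullback d \<gamma> k a0 \<phi> t w \<noteq> 0}"
    then have "\<phi> (t, ?m *\<^sub>R w) \<noteq> 0" by (auto simp: pullback_def)
    then have "norm (t, ?m *\<^sub>R w) \<le> R"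
      using closure_subset[of "{x. \<phi> x \<noteq> 0}"] by (intro R) blast
    then have "norm (?m *\<^sub>R w) \<le> R" using norm_snd_le[of "?m *\<^sub>R w" t] by linarith
    then show "w \<in> cball 0 (R / ?m)" using m by (simp add: field_simps)
  qed
  then have "bounded {w. pullback d \<gamma> k a0 \<phi> t w \<noteq> 0}" by (rule bounded_subset[OF bounded_cball])
  moreover have "Ck m (pullback d \<gamma> k a0 \<phi> t)" for m
    unfolding pullback_def using \<phi> by (intro Ck_mult Ck_const Ck_chirp Ck_scale_slice) (auto simp: test_function_def)
  ultimately show ?thesis by (auto simp: test_function_def compact_closure)
qed

section \<open>The weak equation\<close>

lemma psi_eq_modulate:
  assumes "chirp_rate k a0 I a" "t \<in> I"
  shows "psi d \<gamma> A a t = modulate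
    (of_real (dilation_sq k a0 t powr (- (real d / 4))) * exp (\<i> * of_real (\<gamma> * clock k a0 t)))
    (1 / sqrt (dilation_sq k a0 t)) (rate_num k a0 t / (4 * dilation_sq k a0 t)) A"
  by (intro ext) (simp add: psi_explicit[OF assms] modulate_def mult_ac)

lemma continuous_on_box_op:
  assumes "Ck (Suc (Suc 0)) f"
  shows "continuous_on UNIV (box_op f)"
proof -
  have "continuous_on UNIV (partial b (partial b f))" if "b \<in> Basis" for b
    using Ck_partial[OF Ck_partial[OF assms that] that] by (simp only: Ck.simps(1))
  then show ?thesis
    unfolding box_op_def[abs_def] by (intro continuous_intros) (auto simp: Basis_pair)
qed

lemma borel_measurable_lebesgue_continuous:
  "continuous_on UNIV f \<Longrightarrow> f \<in> borel_measurable lebesgue"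
  by (rule measurable_completion) (simp add: borel_measurable_continuous_onI)

text \<open>Allows the nonlinear term to be integrated against test functions separately from the
  linear ones.\<close>

lemma Linf_power_nonlinearity:
  assumes "Linf A" "0 \<le> \<sigma>"
  shows "Linf (\<lambda>z. of_real (lam * norm (A z) powr \<sigma>) * A z)"
proof -
  have [measurable]: "A \<in> borel_measurable lebesgue" using assms by (simp add: Linf_def)
  obtain N where N: "0 \<le> N" "AE z in lebesgue. norm (A z) \<le> N"
    using Linf_norm_cases[OF assms(1)] by metis
  have m: "(\<lambda>z. of_real (lam * norm (A z) powr \<sigma>) * A z) \<in> borel_measurable lebesgue"
    by measurable
  have "Linf_norm (\<lambda>z. of_real (lam * norm (A z) powr \<sigma>) * A z) \<le> ereal (\<bar>lam\<bar> * N powr \<sigma> * N)"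
  proof (rule Linf_norm_leI[OF m])
    show "AE z in lebesgue. ereal (norm (of_real (lam * norm (A z) powr \<sigma>) * A z)) \<le> ereal (\<bar>lam\<bar> * N powr \<sigma> * N)"
      using N(2)
    proof eventually_elim
      case (elim z)
      have "\<bar>lam\<bar> * norm (A z) powr \<sigma> * norm (A z) \<le> \<bar>lam\<bar> * N powr \<sigma> * N"
        using elim assms(2) N(1) by (intro mult_mono powr_mono2) auto
      then show ?case by (simp add: norm_mult abs_mult)
    qed
  qed
  then show ?thesis using m by (auto simp: Linf_def)
qed

lemma pullback_deriv_outside_support:
  assumes "(t, sqrt (dilation_sq k a0 t) *\<^sub>R w) \<notin> closure {x. \<phi> x \<noteq> 0}"
  shows "pullback_deriv d \<gamma> k a0 \<phi> t w = 0"
proof -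
  have "\<phi> (t, sqrt (dilation_sq k a0 t) *\<^sub>R w) = 0"
    using assms closure_subset[of "{x. \<phi> x \<noteq> 0}"] by blast
  then show ?thesis
    unfolding pullback_deriv_def Let_def radial_derivative_def
    by (simp only: partial_outside_support[OF assms]) simp
qed

text \<open>The nonlinearity gains the factor (m^(- d / 2))^(4 / d) = m^(-2), the one in front of
  the stationary operator in \<open>pullback_box_op\<close>. The identity is pointwise in
  \<open>w\<close>, before any integration.\<close>

lemma hnls_integrand_pullback:
  fixes A :: "real \<times> (real^'n) \<Rightarrow> complex" and \<phi> :: "real \<times> (real \<times> (real^'n)) \<Rightarrow> complex" and \<gamma> :: real
  assumes d: "d = CARD('n) + 1" and a: "chirp_rate k a0 I a" and t: "t \<in> I" and \<phi>: "\<And>m. Ck m \<phi>"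
  defines "q \<equiv> dilation_sq k a0 t" and "u \<equiv> psi d \<gamma> A a t" and "g \<equiv> pullback d \<gamma> k a0 \<phi> t"
  shows "of_real (sqrt q ^ d) * (u (sqrt q *\<^sub>R w) * (- \<i> * partial (1, 0) \<phi> (t, sqrt q *\<^sub>R w)
        + box_op (\<lambda>w. \<phi> (t, w)) (sqrt q *\<^sub>R w))
      + of_real (lam * norm (u (sqrt q *\<^sub>R w)) powr (4 / real d)) * u (sqrt q *\<^sub>R w) * \<phi> (t, sqrt q *\<^sub>R w))
    = - \<i> * (A w * pullback_deriv d \<gamma> k a0 \<phi> t w)
      + of_real (1 / q) * ((A w * box_op g w + of_real (lam * norm (A w) powr (4 / real d)) * A w * g w)
          - of_real (k * hyp w + \<gamma>) * A w * g w)"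
proof -
  let ?p = "rate_num k a0 t" and ?s = "4 / real d" and ?K = "envelope d \<gamma> k a0 t"
  let ?x = "(t, sqrt q *\<^sub>R w)"
  let ?E = "exp (\<i> * complex_of_real (\<gamma> * clock k a0 t))"
  have tl: "t \<in> lifespan k a0" using chirp_rate_subset_lifespan[OF a] t by auto
  have q: "q > 0" using dilation_sq_pos[OF tl] by (simp add: q_def)
  have d0: "real d > 0" using d by simp
  have u: "u (sqrt q *\<^sub>R w) = of_real (q powr (- (real d / 4))) * A w * chirp (?p / 4) w * ?E"
    using q unfolding u_def psi_explicit[OF a t] q_def[symmetric] by (simp add: chirp_scaleR)
  \<comment> \<open>The exponents combine as d / 2 - d / 4 = d / 4, which is that of the
    envelope.\<close>
  have "sqrt q ^ d = q powr (real d / 2)"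
    using q by (simp add: powr_half_sqrt[symmetric] powr_powr flip: powr_realpow)
  then have md: "sqrt q ^ d * q powr (- (real d / 4)) = q powr (real d / 4)"
    by (simp add: powr_add[symmetric])
  have Ku: "of_real (sqrt q ^ d) * u (sqrt q *\<^sub>R w) = ?K * chirp (?p / 4) w * A w"
    unfolding u envelope_def q_def[symmetric] md[symmetric] by (simp add: mult_ac)
  have "norm (u (sqrt q *\<^sub>R w)) = q powr (- (real d / 4)) * norm (A w)"
    unfolding u by (simp add: norm_mult)
  then have "norm (u (sqrt q *\<^sub>R w)) powr ?s = (q powr (- (real d / 4))) powr ?s * norm (A w) powr ?s"
    by (simp add: powr_mult)
  also have "(q powr (- (real d / 4))) powr ?s = 1 / q"
    unfolding powr_powr using d0 q by (simp add: powr_minus inverse_eq_divide powr_neg_one)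
  finally have nu: "norm (u (sqrt q *\<^sub>R w)) powr ?s = 1 / q * norm (A w) powr ?s" .
  have "of_real (sqrt q ^ d) * (u (sqrt q *\<^sub>R w) * (- \<i> * partial (1, 0) \<phi> ?x
        + box_op (\<lambda>w. \<phi> (t, w)) (sqrt q *\<^sub>R w))
      + of_real (lam * norm (u (sqrt q *\<^sub>R w)) powr ?s) * u (sqrt q *\<^sub>R w) * \<phi> ?x)
    = (of_real (sqrt q ^ d) * u (sqrt q *\<^sub>R w)) * (- \<i> * partial (1, 0) \<phi> ?x
        + box_op (\<lambda>w. \<phi> (t, w)) (sqrt q *\<^sub>R w))
      + of_real (lam * norm (u (sqrt q *\<^sub>R w)) powr ?s) * (of_real (sqrt q ^ d) * u (sqrt q *\<^sub>R w)) * \<phi> ?x"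
    by (simp add: algebra_simps)
  also have "\<dots> = A w * (?K * chirp (?p / 4) w * (- \<i> * partial (1, 0) \<phi> ?x
        + box_op (\<lambda>w. \<phi> (t, w)) (sqrt q *\<^sub>R w)))
      + of_real (lam * (1 / q * norm (A w) powr ?s)) * A w * (?K * (chirp (?p / 4) w * \<phi> ?x))"
    unfolding Ku nu by (simp add: mult_ac)
  also have "?K * (chirp (?p / 4) w * \<phi> ?x) = g w"
    by (simp add: g_def pullback_def q_def)
  also have "?K * chirp (?p / 4) w * (- \<i> * partial (1, 0) \<phi> ?x + box_op (\<lambda>w. \<phi> (t, w)) (sqrt q *\<^sub>R w))
    = - \<i> * pullback_deriv d \<gamma> k a0 \<phi> t w + of_real (1 / q) * (box_op g w - of_real (k * hyp w + \<gamma>) * g w)"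
    unfolding q_def g_def by (rule pullback_box_op[OF tl \<phi> d])
  finally show ?thesis by (simp add: algebra_simps)
qed

lemma hnls_distributional_psi:
  fixes A :: "real \<times> (real^'n) \<Rightarrow> complex"
  assumes d: "d = CARD('n) + 1" and A: "Linf A" and stat: "stationary_solution lam (4 / real d) k \<gamma> A"
    and a: "chirp_rate k a0 I a"
  shows "hnls_distributional lam (4 / real d) I (psi d \<gamma> A a)"
  unfolding hnls_distributional_def
proof (intro allI impI)
  fix \<phi> :: "real \<times> (real \<times> (real^'n)) \<Rightarrow> complex"
  assume \<phi>: "test_function (interior I \<times> UNIV) \<phi>"
  define S where "S = closure {x. \<phi> x \<noteq> 0}"
  let ?J = "interior I" and ?u = "psi d \<gamma> A a"
  define inner where "inner t = (LINT z|lebesgue. ?u t z * (- \<i> * partial (1, 0) \<phi> (t, z) + box_op (\<lambda>w. \<phi> (t, w)) z)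
          + of_real (lam * norm (?u t z) powr (4 / real d)) * ?u t z * \<phi> (t, z))" for t
  have C: "Ck m \<phi>" for m using \<phi> unfolding test_function_def by blast
  have \<phi>0: "\<phi> x = 0" "partial b \<phi> x = 0" if "x \<notin> S" for x b
    using that partial_outside_support[of x \<phi> b] closure_subset[of "{x. \<phi> x \<noteq> 0}"]
    unfolding S_def by blast+
  have inner0: "inner t = 0" if "\<And>z. (t, z) \<notin> S" for t
  proof -
    have "(\<lambda>w. \<phi> (t, w)) = (\<lambda>w. 0)" using \<phi>0(1)[OF that] by (intro ext)
    moreover have "partial b (\<lambda>w. 0) = (\<lambda>w. 0)" for b :: "real \<times> (real^'n)"
      by (intro ext partial_const)
    ultimately show ?thesis
      unfolding inner_def \<phi>0(1)[OF that] \<phi>0(2)[OF that] by (simp add: box_op_def)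
  qed
  have "(LINT t|lebesgue. inner t) = 0"
  proof (cases "?J = {}")
    \<comment> \<open>Without interior times every admissible \<open>\<phi>\<close> has empty
      support.\<close>
    case True
    then have "S = {}" using \<phi> unfolding S_def test_function_def by simp
    then show ?thesis using inner0 by simp
  next
    case False
    have I: "is_interval I" using a by (simp add: chirp_rate_def)
    then have "is_interval ?J" by (simp add: is_interval_convex_1 convex_interior)
    then obtain \<alpha> \<beta> R where ab: "\<alpha> \<le> \<beta>" "{\<alpha>..\<beta>} \<subseteq> ?J"
      and slab: "\<And>t z. (t, z) \<in> S \<Longrightarrow> \<alpha> < t \<and> t < \<beta> \<and> norm z \<le> R"
      using test_function_slab[OF open_interior _ False \<phi>] unfolding S_def by metis
    have abI: "{\<alpha>..\<beta>} \<subseteq> I" using ab(2) interior_subset by blast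
    have abL: "{\<alpha>..\<beta>} \<subseteq> lifespan k a0" using abI chirp_rate_subset_lifespan[OF a] by blast
    define G where "G = pullback_deriv d \<gamma> k a0 \<phi>"
    \<comment> \<open>The minimum of m over the slab bounds the support uniformly in time: norm (m
      w) <= R forces norm w <= R / \<delta>.\<close>
    obtain t0 where t0: "t0 \<in> {\<alpha>..\<beta>}" "\<And>t. t \<in> {\<alpha>..\<beta>} \<Longrightarrow> dilation_sq k a0 t0 \<le> dilation_sq k a0 t"
      using continuous_attains_inf[of "{\<alpha>..\<beta>}" "dilation_sq k a0"] ab(1) continuous_on_dilation_sq by auto
    define \<delta> where "\<delta> = sqrt (dilation_sq k a0 t0)"
    have \<delta>: "\<delta> > 0" using dilation_sq_pos t0(1) abL by (auto simp: \<delta>_def)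
    have Gsupp: "G t w = 0" if "t \<in> {\<alpha>..\<beta>}" "w \<notin> cball 0 (R / \<delta>)" for t w
      unfolding G_def
    proof (rule pullback_deriv_outside_support, rule notI)
      assume "(t, sqrt (dilation_sq k a0 t) *\<^sub>R w) \<in> closure {x. \<phi> x \<noteq> 0}"
      then have "norm (sqrt (dilation_sq k a0 t) *\<^sub>R w) \<le> R" using slab unfolding S_def by blast
      moreover have "\<delta> \<le> \<bar>sqrt (dilation_sq k a0 t)\<bar>" using real_sqrt_le_mono[OF t0(2)[OF that(1)]] unfolding \<delta>_def by linarith
      ultimately have "\<delta> * norm w \<le> R" by (smt (verit) mult_right_mono norm_ge_zero norm_scaleR)
      then show False using that(2) \<delta> by (simp add: field_simps)
    qed
    have Gcont: "continuous_on ({\<alpha>..\<beta>} \<times> UNIV) (\<lambda>x. G (fst x) (snd x))"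
      unfolding G_def by (rule continuous_on_pullback_deriv[OF abL C])
    have inner: "inner t = - \<i> * (LINT w|lebesgue. A w * G t w)" if t: "t \<in> {\<alpha>..\<beta>}" for t
    proof -
      have tI: "t \<in> I" and tL: "t \<in> lifespan k a0" using t abI abL by auto
      define q where "q = dilation_sq k a0 t"
      have q: "q > 0" using dilation_sq_pos[OF tL] by (simp add: q_def)
      define g where "g = pullback d \<gamma> k a0 \<phi> t"
      have g: "test_function UNIV g" unfolding g_def by (rule test_function_pullback[OF tL \<phi>])
      have um: "?u t \<in> borel_measurable lebesgue"
        unfolding psi_eq_modulate[OF a tI] using A by (intro borel_measurable_modulate) (simp add: Linf_def)
      have slice: "continuous_on UNIV (\<lambda>z. f (t, z))" if "continuous_on UNIV f"
        for f :: "real \<times> (real \<times> (real^'n)) \<Rightarrow> complex"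
        by (rule continuous_on_compose2[OF that]) (auto intro!: continuous_intros)
      have B: "(1, 0) \<in> (Basis :: (real \<times> (real \<times> (real^'n))) set)" by (auto simp: Basis_prod_def)
      have Cs: "Ck m (\<lambda>z. \<phi> (t, z))" for m using Ck_scale_slice[OF C, of m t 1] by simp
      have [measurable]: "(\<lambda>z. \<phi> (t, z)) \<in> borel_measurable lebesgue"
        "(\<lambda>z. partial (1, 0) \<phi> (t, z)) \<in> borel_measurable lebesgue"
        "box_op (\<lambda>w. \<phi> (t, w)) \<in> borel_measurable lebesgue"
        by (intro borel_measurable_lebesgue_continuous slice continuous_on_box_op Cs
            Ck_imp_continuous_on[OF C] Ck_imp_continuous_on[OF Ck_partial[OF C B]])+
      note [measurable] = um
      define F where "F z = ?u t z * (- \<i> * partial (1, 0) \<phi> (t, z) + box_op (\<lambda>w. \<phi> (t, w)) z)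
          + of_real (lam * norm (?u t z) powr (4 / real d)) * ?u t z * \<phi> (t, z)" for z
      have Fm: "F \<in> borel_measurable lebesgue" unfolding F_def[abs_def] by measurable
      have D: "DIM(real \<times> (real^'n)) = d" using d by simp
      have "inner t = (LINT w|lebesgue. F w)"
        unfolding inner_def F_def[abs_def] ..
      also have "\<dots> = sqrt q ^ d *\<^sub>R (LINT w|lebesgue. F (sqrt q *\<^sub>R w))"
        using integral_lebesgue_scaleR[OF Fm, of "sqrt q", unfolded D] q by simp
      also have "\<dots> = (LINT w|lebesgue. of_real (sqrt q ^ d) * F (sqrt q *\<^sub>R w))"
        by (simp only: scaleR_conv_of_real integral_mult_right_zero)
      also have "\<dots> = (LINT w|lebesgue. - \<i> * (A w * G t w)
          + of_real (1 / q) * ((A w * box_op g w + of_real (lam * norm (A w) powr (4 / real d)) * A w * g w)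
              - of_real (k * hyp w + \<gamma>) * A w * g w))"
        unfolding F_def G_def g_def q_def hnls_integrand_pullback[OF d a tI C] ..
      also have "\<dots> = - \<i> * (LINT w|lebesgue. A w * G t w)
          + of_real (1 / q) * ((LINT w|lebesgue. A w * box_op g w + of_real (lam * norm (A w) powr (4 / real d)) * A w * g w)
              - (LINT w|lebesgue. of_real (k * hyp w + \<gamma>) * A w * g w))"
      proof -
        have "continuous_on UNIV (\<lambda>w. G (fst (t, w)) (snd (t, w)))"
          by (rule continuous_on_compose2[OF Gcont]) (use t in \<open>auto intro!: continuous_intros\<close>)
        then have "integrable lebesgue (G t)"
          using integrable_lebesgue_compact_support[of "G t" "R / \<delta>"] Gsupp[OF t] by simp
        then have 1: "integrable lebesgue (\<lambda>w. A w * G t w)" by (rule Linf_mult_integrable[OF A])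
        have 2: "integrable lebesgue (\<lambda>w. A w * box_op g w)"
          by (rule Linf_mult_integrable[OF A test_function_box_op_integrable[OF g]])
        have "integrable lebesgue g" using test_function_integrable[OF g, of "\<lambda>_. 1"] by simp
        then have 3: "integrable lebesgue (\<lambda>w. of_real (lam * norm (A w) powr (4 / real d)) * A w * g w)"
          by (intro Linf_mult_integrable[OF Linf_power_nonlinearity[OF A]]) simp
        \<comment> \<open>\<open>hyp\<close> is unbounded, so it is absorbed into the compactly
          supported \<open>g\<close> before \<open>A\<close> is multiplied in.\<close>
        have "integrable lebesgue (\<lambda>w. of_real (k * hyp w + \<gamma>) * g w)"
          by (intro test_function_integrable[OF g] continuous_intros)
        from Linf_mult_integrable[OF A this]
        have 4: "integrable lebesgue (\<lambda>w. of_real (k * hyp w + \<gamma>) * A w * g w)"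
          by (simp only: mult_ac)
        show ?thesis
          using 1 2 3 4 by (simp only: Bochner_Integration.integral_add Bochner_Integration.integral_diff
            integral_mult_right_zero Bochner_Integration.integrable_add Bochner_Integration.integrable_diff
            integrable_mult_right simp_thms)
      qed
      also have "(LINT w|lebesgue. A w * box_op g w + of_real (lam * norm (A w) powr (4 / real d)) * A w * g w)
          = (LINT w|lebesgue. of_real (k * hyp w + \<gamma>) * A w * g w)"
        using stat g unfolding stationary_solution_def by blast
      finally show ?thesis by simp
    qed
    have "inner = (\<lambda>t. - \<i> * (indicat_real {\<alpha>..\<beta>} t *\<^sub>R (LINT w|lebesgue. A w * G t w)))"
    proof
      fix t
      show "inner t = - \<i> * (indicat_real {\<alpha>..\<beta>} t *\<^sub>R (LINT w|lebesgue. A w * G t w))"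
      proof (cases "t \<in> {\<alpha>..\<beta>}")
        case False
        then have "(t, z) \<notin> S" for z using slab[of t z] by auto
        then show ?thesis using False inner0 by simp
      qed (simp add: inner)
    qed
    moreover have "(LINT t|lebesgue. indicat_real {\<alpha>..\<beta>} t *\<^sub>R (LINT w|lebesgue. A w * G t w)) = 0"
    proof (rule integral_time_derivative_eq_0[OF A ab(1) Gcont Gsupp])
      show "((\<lambda>t. pullback d \<gamma> k a0 \<phi> t w) has_vector_derivative G t w) (at t)" if "t \<in> {\<alpha>..\<beta>}" for t w
        unfolding G_def using that abL by (intro pullback_has_vector_derivative Ck_differentiable[OF C]) auto
      \<comment> \<open>\<open>slab\<close> is strict in time, so the support of
        \<open>\<phi>\<close> has no point at the times \<alpha> and \<beta>.\<close>
      show "pullback d \<gamma> k a0 \<phi> \<alpha> w = 0" "pullback d \<gamma> k a0 \<phi> \<beta> w = 0" for w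
        unfolding pullback_def using \<phi>0(1) slab by (metis less_irrefl mult_zero_right)+
    qed
    ultimately show ?thesis by (simp only: integral_mult_right_zero mult_zero_right)
  qed
  then show "(LINT t|lebesgue. LINT z|lebesgue. ?u t z * (- \<i> * partial (1, 0) \<phi> (t, z) + box_op (\<lambda>w. \<phi> (t, w)) z)
          + of_real (lam * norm (?u t z) powr (4 / real d)) * ?u t z * \<phi> (t, z)) = 0"
    unfolding inner_def .
qed

lemma weak_star_continuous_in_Linf_cong:
  assumes "\<And>t. t \<in> I \<Longrightarrow> u t = v t"
  shows "weak_star_continuous_in_Linf I u \<longleftrightarrow> weak_star_continuous_in_Linf I v"
  unfolding weak_star_continuous_in_Linf_def
  by (simp add: assms cong: ball_cong continuous_on_cong)

lemma norm_continuous_in_Linf_cong: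
  assumes "\<And>t. t \<in> I \<Longrightarrow> u t = v t"
  shows "norm_continuous_in_Linf I u \<longleftrightarrow> norm_continuous_in_Linf I v"
proof -
  have "((\<lambda>s. Linf_norm (\<lambda>z. u s z - u t z)) \<longlongrightarrow> 0) (at t within I)
      \<longleftrightarrow> ((\<lambda>s. Linf_norm (\<lambda>z. v s z - v t z)) \<longlongrightarrow> 0) (at t within I)" if "t \<in> I" for t
    by (rule tendsto_cong) (use assms that in \<open>auto simp: eventually_at_filter\<close>)
  then show ?thesis
    unfolding norm_continuous_in_Linf_def by (simp add: assms cong: ball_cong)
qed

lemma semiclassical_psi:
  fixes A :: "real \<times> (real^'n) \<Rightarrow> complex"
  assumes d: "d = CARD('n) + 1" and A: "Linf A" and stat: "stationary_solution lam (4 / real d) k \<gamma> A"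
    and a: "chirp_rate k a0 I a"
  shows "weak_star_semiclassical_solution lam (4 / real d) I (psi d \<gamma> A a)"
    and "dilation_chirp_continuous A \<Longrightarrow> semiclassical_solution lam (4 / real d) I (psi d \<gamma> A a)"
proof -
  let ?q = "dilation_sq k a0"
  have I: "I \<subseteq> lifespan k a0" by (rule chirp_rate_subset_lifespan[OF a])
  have q: "?q t > 0" if "t \<in> I" for t using dilation_sq_pos I that by auto
  define \<alpha> where "\<alpha> t = complex_of_real (?q t powr (- (real d / 4))) * exp (\<i> * of_real (\<gamma> * clock k a0 t))" for t
  define r where "r t = 1 / sqrt (?q t)" for t
  define p where "p t = rate_num k a0 t / (4 * ?q t)" for t
  have u: "psi d \<gamma> A a t = modulate (\<alpha> t) (r t) (p t) A" if "t \<in> I" for t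
    unfolding psi_eq_modulate[OF a that] \<alpha>_def r_def p_def ..
  have c: "continuous_on I \<alpha>" "continuous_on I r" "continuous_on I p"
    unfolding \<alpha>_def[abs_def] r_def[abs_def] p_def[abs_def]
    by (intro continuous_intros continuous_on_subset[OF continuous_on_clock I]; use q in force)+
  have nz: "\<alpha> t \<noteq> 0" "r t > 0" if "t \<in> I" for t
    using q[OF that] by (auto simp: \<alpha>_def r_def)
  have hnls: "hnls_distributional lam (4 / real d) I (psi d \<gamma> A a)"
    by (rule hnls_distributional_psi[OF d A stat a])
  have "weak_star_continuous_in_Linf I (psi d \<gamma> A a)"
    by (rule iffD2[OF weak_star_continuous_in_Linf_cong[OF u] weak_star_continuous_modulate[OF A c nz]])
  with hnls show "weak_star_semiclassical_solution lam (4 / real d) I (psi d \<gamma> A a)"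
    by (simp add: weak_star_semiclassical_solution_def)
  assume "dilation_chirp_continuous A"
  then have "norm_continuous_in_Linf I (psi d \<gamma> A a)"
    by (intro iffD2[OF norm_continuous_in_Linf_cong[OF u] norm_continuous_modulate[OF A c nz]])
  with hnls show "semiclassical_solution lam (4 / real d) I (psi d \<gamma> A a)"
    by (simp add: semiclassical_solution_def)
qed

section \<open>Blow-up and decay\<close>

text \<open>This is how the condition on the value of \<open>A0\<close> at the origin enters: were
  the norm 0, all averages over balls would be 0, and so would their limit.\<close>

lemma Linf_norm_pos_if_has_value:
  assumes A: "Linf A" and c: "has_value_at A z c" "c \<noteq> 0"
  obtains N where "N > 0" "Linf_norm A = ereal N"
proof -
  obtain N where N: "0 \<le> N" "Linf_norm A = ereal N" "AE w in lebesgue. norm (A w) \<le> N"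
    by (rule Linf_norm_cases[OF A])
  have "N \<noteq> 0"
  proof
    assume "N = 0"
    with N(3) have "AE w in lebesgue. A w = 0" by simp
    then have "has_value_at (\<lambda>_. 0) z c"
      using has_value_at_cong_AE[of A "\<lambda>_. 0" z c] A c(1) by (simp add: Linf_def)
    then have "((\<lambda>r :: real. 0) \<longlongrightarrow> c) (at_right 0)"
      by (simp add: has_value_at_def set_lebesgue_integral_def)
    then have "0 = c" by (rule tendsto_unique[OF trivial_limit_at_right_real tendsto_const])
    with c(2) show False by simp
  qed
  with N that show ?thesis by auto
qed

lemma Linf_norm_psi:
  assumes a: "chirp_rate k a0 I a" and t: "t \<in> I" and A: "Linf A" "Linf_norm A = ereal N"
  shows "Linf_norm (psi d \<gamma> A a t) = ereal (dilation_sq k a0 t powr (- (real d / 4)) * N)"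
proof -
  have "dilation_sq k a0 t > 0"
    by (rule dilation_sq_pos[OF subsetD[OF chirp_rate_subset_lifespan[OF a] t]])
  then show ?thesis
    unfolding psi_eq_modulate[OF a t] using A
    by (subst Linf_norm_modulate) (auto simp: Linf_def norm_mult)
qed

text \<open>\<open>J\<close> certifies that no zero of q separates 0 from \<open>T\<close>, so
  \<open>T\<close> is an endpoint of the lifespan and not a root beyond it. There q tends to 0 and q
  powr (- d / 4) to infinity.\<close>

lemma blows_up_at_root:
  fixes T :: real
  assumes a: "maximal_chirp_rate k a0 I a" and A: "Linf A" "Linf_norm A = ereal N" "N > 0" and d: "d > 0"
    and T: "dilation_sq k a0 T = 0"
    and J: "is_interval J" "0 \<in> J" "\<And>t. t \<in> J \<Longrightarrow> dilation_sq k a0 t > 0" "T islimpt J"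
  shows "blows_up_at (psi d \<gamma> A a) I T"
  unfolding blows_up_at_def
proof (intro conjI)
  let ?q = "dilation_sq k a0" and ?F = "at T within I"
  have I: "I = lifespan k a0" by (rule maximal_chirp_rate_eq_lifespan[OF a])
  have a': "chirp_rate k a0 I a" using a by (simp add: maximal_chirp_rate_def)
  have q: "?q t > 0" if "t \<in> I" for t using that I dilation_sq_pos by auto
  show "T \<notin> I" using q[of T] T by auto
  have "J \<subseteq> I" unfolding I by (rule subset_lifespan[OF J(1-3)])
  then show "T islimpt I" using J(4) by (rule islimpt_subset[rotated])
  have "(?q \<longlongrightarrow> 0) ?F"
    using continuous_on_dilation_sq[of UNIV k a0] T
    by (metis UNIV_I continuous_on_def tendsto_within_subset subset_UNIV)
  then have "((\<lambda>t. ?q t powr (real d / 4)) \<longlongrightarrow> 0 powr (real d / 4)) ?F"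
  \<comment> \<open>The base tends to 0, so the power converges thanks to nonnegative values along
    the filter and a positive exponent.\<close>
  proof (rule tendsto_powr2[OF _ tendsto_const])
    show "\<forall>\<^sub>F t in ?F. 0 \<le> ?q t" using q by (auto simp: eventually_at_filter less_imp_le)
  qed (use d in simp)
  then have "((\<lambda>t. ?q t powr (real d / 4)) \<longlongrightarrow> 0) ?F" by simp
  moreover have "\<forall>\<^sub>F t in ?F. 0 < ?q t powr (real d / 4)"
    unfolding eventually_at_filter by (rule always_eventually) (auto dest: q)
  ultimately have "LIM t ?F. inverse (?q t powr (real d / 4)) :> at_top"
    by (rule filterlim_inverse_at_top)
  then have "LIM t ?F. N * inverse (?q t powr (real d / 4)) :> at_top"
    by (rule filterlim_tendsto_pos_mult_at_top[OF tendsto_const A(3)])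
  then have "((\<lambda>t. ereal (N * inverse (?q t powr (real d / 4)))) \<longlongrightarrow> \<infinity>) ?F"
    by (simp add: tendsto_PInfty_eq_at_top)
  moreover have "\<forall>\<^sub>F t in ?F. ereal (N * inverse (?q t powr (real d / 4))) = Linf_norm (psi d \<gamma> A a t)"
    unfolding eventually_at_filter
    by (rule always_eventually) (simp add: Linf_norm_psi[OF a' _ A(1,2)] powr_minus mult.commute)
  ultimately show "((\<lambda>t. Linf_norm (psi d \<gamma> A a t)) \<longlongrightarrow> \<infinity>) ?F"
    by (rule Lim_transform_eventually)
qed

section \<open>Blow-up times as roots of the quadratic\<close>

lemma blows_up_at_positive_root:
  assumes "maximal_chirp_rate k a0 I a" "Linf A" "Linf_norm A = ereal N" "N > 0" "d > 0"
    and "dilation_sq k a0 T = 0" "T > 0" "\<And>t. 0 \<le> t \<Longrightarrow> t < T \<Longrightarrow> dilation_sq k a0 t > 0"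
  shows "blows_up_at (psi d \<gamma> A a) I T"
proof (rule blows_up_at_root[OF assms(1-6), where J = "{0..<T}"])
  have "T islimpt {0<..<T}" using assms(7) by (simp add: islimpt_greaterThanLessThan2)
  then show "T islimpt {0..<T}" by (rule islimpt_subset) auto
qed (use assms(7,8) in \<open>auto simp: is_interval_1\<close>)

lemma blows_up_at_negative_root:
  assumes "maximal_chirp_rate k a0 I a" "Linf A" "Linf_norm A = ereal N" "N > 0" "d > 0"
    and "dilation_sq k a0 T = 0" "T < 0" "\<And>t. T < t \<Longrightarrow> t \<le> 0 \<Longrightarrow> dilation_sq k a0 t > 0"
  shows "blows_up_at (psi d \<gamma> A a) I T"
proof (rule blows_up_at_root[OF assms(1-6), where J = "{T<..0}"])
  have "T islimpt {T<..<0}" using assms(7) by (simp add: islimpt_greaterThanLessThan1)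
  then show "T islimpt {T<..0}" by (rule islimpt_subset) auto
qed (use assms(7,8) in \<open>auto simp: is_interval_1\<close>)

text \<open>With s = sqrt (- k) the polynomial is the difference of squares (1 + a0 t)^2 - (2 s
  t)^2.\<close>

lemma dilation_sq_factor:
  assumes "k \<le> 0"
  shows "dilation_sq k a0 t = (1 + (a0 + 2 * sqrt (- k)) * t) * (1 + (a0 - 2 * sqrt (- k)) * t)"
proof -
  define s where "s = sqrt (- k)"
  have "k = - (s * s)" using assms by (simp add: s_def)
  then show ?thesis
    unfolding dilation_sq_def s_def[symmetric] by (simp add: algebra_simps power2_eq_square)
qed

text \<open>The time is the root of the factor with slope a0 - 2 s; for t >= 0 the other factor is
  larger by 4 s t and cannot vanish earlier. For k = 0 this is the time - 1 / a0.\<close>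

lemma blow_up_focusing_forward:
  assumes "maximal_chirp_rate k a0 I a" "Linf A" "Linf_norm A = ereal N" "N > 0" "d > 0"
    and k: "k \<le> 0" and a0: "a0 < 2 * sqrt (- k)"
  shows "blows_up_at (psi d \<gamma> A a) I (1 / (2 * sqrt (- k) - a0))"
proof (rule blows_up_at_positive_root[OF assms(1-5)])
  let ?s = "sqrt (- k)" and ?T = "1 / (2 * sqrt (- k) - a0)"
  show "?T > 0" using a0 by simp
  show "dilation_sq k a0 ?T = 0"
    using a0 unfolding dilation_sq_factor[OF k] by (simp add: field_simps)
  fix t assume t: "0 \<le> t" "t < ?T"
  then have "(2 * ?s - a0) * t < 1" using a0 by (simp add: field_simps)
  then have 1: "1 + (a0 - 2 * ?s) * t > 0" by (simp add: algebra_simps)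
  have "0 \<le> ?s * t" using t k by simp
  then have "1 + (a0 + 2 * ?s) * t > 0" using 1 by (simp add: algebra_simps)
  with 1 show "dilation_sq k a0 t > 0" unfolding dilation_sq_factor[OF k] by simp
qed

text \<open>The mirror image: the factor with slope a0 + 2 s vanishes in the past, and for t <= 0
  the other one is at least as large.\<close>

lemma blow_up_focusing_backward:
  assumes "maximal_chirp_rate k a0 I a" "Linf A" "Linf_norm A = ereal N" "N > 0" "d > 0"
    and k: "k \<le> 0" and a0: "a0 + 2 * sqrt (- k) > 0"
  shows "blows_up_at (psi d \<gamma> A a) I (- 1 / (a0 + 2 * sqrt (- k)))"
proof (rule blows_up_at_negative_root[OF assms(1-5)])
  let ?s = "sqrt (- k)" and ?T = "- 1 / (a0 + 2 * sqrt (- k))"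
  show "?T < 0" using a0 by simp
  show "dilation_sq k a0 ?T = 0"
    using a0 unfolding dilation_sq_factor[OF k] by (simp add: field_simps)
  fix t assume t: "?T < t" "t \<le> 0"
  then have 1: "1 + (a0 + 2 * ?s) * t > 0" using a0 by (simp add: field_simps)
  have "?s * t \<le> 0" using t k by (intro mult_nonneg_nonpos) auto
  then have "1 + (a0 - 2 * ?s) * t > 0" using 1 by (simp add: algebra_simps)
  with 1 show "dilation_sq k a0 t > 0" unfolding dilation_sq_factor[OF k] by simp
qed

text \<open>Completing the square isolates 4 k t^2 independently of \<open>a0\<close>, which gives
  both global existence and decay for k > 0.\<close>

lemma dilation_sq_ge: "dilation_sq k a0 t \<ge> 4 * k * t\<^sup>2"
proof -
  have "dilation_sq k a0 t = (1 + a0 * t)\<^sup>2 + 4 * k * t\<^sup>2"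
    by (simp add: dilation_sq_def algebra_simps power2_eq_square)
  then show ?thesis by simp
qed

lemma lifespan_defocusing:
  assumes "k > 0" shows "lifespan k a0 = UNIV"
proof -
  have "dilation_sq k a0 t > 0" for t
    using dilation_sq_ge[of k t a0] assms
    \<comment> \<open>At t = 0 the lower bound degenerates, but there the polynomial is 1.\<close>
    by (cases "t = 0") (auto intro: less_le_trans[of _ "4 * k * t\<^sup>2"])
  then show ?thesis using subset_lifespan[of UNIV k a0] by auto
qed

text \<open>The norm is N q powr (- d / 4) with q >= 4 k t^2. Once q >= 1, the condition d >= 2
  bounds the power by 1 / sqrt q, hence by 1 / (2 sqrt k |t|).\<close>

lemma decay_defocusing:
  assumes a: "chirp_rate k a0 UNIV a" and A: "Linf A" "Linf_norm A = ereal N" "N \<ge> 0"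
    and d: "d \<ge> 2" and k: "k > 0"
  shows "\<forall>\<^sub>F t in at_infinity. Linf_norm (psi d \<gamma> A a t) \<le> ereal (N / (2 * sqrt k) / \<bar>t\<bar>)"
  unfolding eventually_at_infinity
proof (intro exI allI impI)
  \<comment> \<open>The threshold is the time at which 4 k t^2 reaches 1, which ensures q >=
    1.\<close>
  fix t :: real assume "norm t \<ge> 1 / (2 * sqrt k)"
  then have t: "\<bar>t\<bar> * (2 * sqrt k) \<ge> 1" using k by (simp add: field_simps)
  let ?q = "dilation_sq k a0 t"
  have sq: "(\<bar>t\<bar> * (2 * sqrt k))\<^sup>2 = 4 * k * t\<^sup>2"
    using k by (simp add: power_mult_distrib)
  then have q: "?q \<ge> (\<bar>t\<bar> * (2 * sqrt k))\<^sup>2" using dilation_sq_ge[of k t a0] by simp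
  have "?q \<ge> 1" using q one_le_power[OF t, of 2] by linarith
  then have "?q powr (- (real d / 4)) \<le> ?q powr (- (1 / 2))"
    using d by (intro powr_mono) auto
  also have "\<dots> = 1 / sqrt ?q" using \<open>?q \<ge> 1\<close> by (simp add: powr_minus powr_half_sqrt inverse_eq_divide)
  also have "\<dots> \<le> 1 / (\<bar>t\<bar> * (2 * sqrt k))"
  proof (rule divide_left_mono)
    show "\<bar>t\<bar> * (2 * sqrt k) \<le> sqrt ?q" using q by (rule real_le_rsqrt)
    show "0 < sqrt ?q * (\<bar>t\<bar> * (2 * sqrt k))" using t k \<open>?q \<ge> 1\<close> by (intro mult_pos_pos) auto
  qed simp
  finally have "?q powr (- (real d / 4)) * N \<le> 1 / (\<bar>t\<bar> * (2 * sqrt k)) * N"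
    using A(3) by (rule mult_right_mono)
  also have "\<dots> = N / (2 * sqrt k) / \<bar>t\<bar>" by (simp add: mult.commute)
  finally show "Linf_norm (psi d \<gamma> A a t) \<le> ereal (N / (2 * sqrt k) / \<bar>t\<bar>)"
    using Linf_norm_psi[OF a _ A(1,2)] by simp
qed

text \<open>Blow-up is stated for the maximal rate, since a shorter interval would miss it. For k <
  0 and a0 >= 2 sqrt (- k) both linear factors stay positive for t >= 0, so the only blow-up lies in
  the past; hence the separate clause for T > 0. For k = 0 and a0 = 0 the polynomial is constantly
  1.\<close>

theorem theorem1:
  fixes A0 :: "real \<times> (real^'n) \<Rightarrow> complex"
    and lam k \<gamma>0 :: real
    and d :: nat
  assumes "d = CARD('n) + 1"
    and "Linf A0"
    and "stationary_solution lam (4 / real d) k \<gamma>0 A0"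
  shows "(\<forall>a0. \<exists>I a. maximal_chirp_rate k a0 I a) \<and>
    (\<forall>a0 I a. chirp_rate k a0 I a \<longrightarrow>
       weak_star_semiclassical_solution lam (4 / real d) I (psi d \<gamma>0 A0 a) \<and>
       (dilation_chirp_continuous A0 \<longrightarrow>
          semiclassical_solution lam (4 / real d) I (psi d \<gamma>0 A0 a))) \<and>
    ((\<exists>c. c \<noteq> 0 \<and> has_value_at A0 0 c) \<longrightarrow>
       (\<forall>a0 I a. maximal_chirp_rate k a0 I a \<longrightarrow>
          (k < 0 \<longrightarrow>
             (\<exists>T. blows_up_at (psi d \<gamma>0 A0 a) I T) \<and>
             (a0 < 2 * sqrt (- k) \<longrightarrow> (\<exists>T>0. blows_up_at (psi d \<gamma>0 A0 a) I T))) \<and>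
          (k = 0 \<longrightarrow> a0 \<noteq> 0 \<longrightarrow> blows_up_at (psi d \<gamma>0 A0 a) I (- 1 / a0)) \<and>
          (k > 0 \<longrightarrow>
             I = UNIV \<and>
             (\<exists>C. \<forall>\<^sub>F t in at_infinity. Linf_norm (psi d \<gamma>0 A0 a t) \<le> ereal (C / \<bar>t\<bar>)))))"
proof (intro conjI allI impI, goal_cases)
  case (1 a0)
  show ?case using maximal_chirp_rate_lifespan by blast
next
  case (2 a0 I a)
  then show ?case by (rule semiclassical_psi(1)[OF assms])
next
  case (3 a0 I a)
  then show ?case by (intro semiclassical_psi(2)[OF assms])
next
  case (4 a0 I a)
  obtain N where N: "N > 0" "Linf_norm A0 = ereal N"
    using 4(1) Linf_norm_pos_if_has_value[OF assms(2)] by metis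
  note blow = 4(2) assms(2) N(2,1)
  show ?case
  \<comment> \<open>Since sqrt (- k) > 0, at least one of a0 < 2 sqrt (- k) and a0 > - 2 sqrt (- k)
    holds. The first yields a root in the future, the second one in the past.\<close>
  proof (cases "a0 < 2 * sqrt (- k)")
    case True
    then show ?thesis using blow_up_focusing_forward[OF blow] assms(1) 4(3) by auto
  next
    case False
    moreover have "sqrt (- k) > 0" using 4(3) by simp
    ultimately have "a0 + 2 * sqrt (- k) > 0" by linarith
    then show ?thesis using blow_up_focusing_backward[OF blow, of d \<gamma>0] assms(1) 4(3) by auto
  qed
next
  case (5 a0 I a)
  obtain N where N: "N > 0" "Linf_norm A0 = ereal N"
    using 5(1) Linf_norm_pos_if_has_value[OF assms(2)] by metis
  then show ?case
    using blow_up_focusing_forward[OF 5(2) assms(2) N(2,1), of d \<gamma>0] assms(1) 5(3,4)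
    by (intro exI[of _ "1 / (2 * sqrt (- k) - a0)"]) auto
next
  case (6 a0 I a)
  obtain N where N: "N > 0" "Linf_norm A0 = ereal N"
    using 6(1) Linf_norm_pos_if_has_value[OF assms(2)] by metis
  note blow = 6(2) assms(2) N(2,1)
  \<comment> \<open>At k = 0 both blow-up times reduce to - 1 / a0; the sign of \<open>a0\<close>
    decides whether it lies ahead or behind.\<close>
  show ?case
    using blow_up_focusing_forward[OF blow, of d \<gamma>0] blow_up_focusing_backward[OF blow, of d \<gamma>0] assms(1) 6(3,4)
    by (cases "a0 < 0") auto
next
  case (7 a0 I a)
  then show ?case using maximal_chirp_rate_eq_lifespan lifespan_defocusing by metis
next
  case (8 a0 I a)
  obtain N where N: "N > 0" "Linf_norm A0 = ereal N"
    using 8(1) Linf_norm_pos_if_has_value[OF assms(2)] by metis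
  have "chirp_rate k a0 UNIV a"
    using 8(2,3) maximal_chirp_rate_eq_lifespan[OF 8(2)] lifespan_defocusing[OF 8(3)]
    by (simp add: maximal_chirp_rate_def)
  moreover have "d \<ge> 2" using assms(1) by (simp add: Suc_leI)
  ultimately show ?case
    using decay_defocusing[OF _ assms(2) N(2) less_imp_le[OF N(1)] _ 8(3)] by blast
qed

end
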